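(* Let $G$ be a 2-connected claw-o-heavy graph of order $n$. If for every induced path $v_1v_2v_3v_4v_5v_6$ on six vertices in $G$ there exist $i\in\{1,2,3\}$ and $j\in\{4,5,6\}$ with $d(v_i)+d(v_j)\geq n$, then $G$ is hamiltonian.
   Context: Graphs are finite, simple and undirected; $d(v)$ is the degree of $v$ in $G$. A graph $G$ on $n$ vertices is claw-o-heavy if every induced subgraph of $G$ isomorphic to $K_{1,3}$ contains two nonadjacent vertices $u,v$ with $d(u)+d(v)\geq n$. An induced path $v_1\cdots v_6$ means an induced subgraph isomorphic to $P_6$ with edges $v_kv_{k+1}$. *)

theory Defs
  imports "Graph_Theory.Graph_Theory"
begin

text \<open>
  Simple undirected graphs are rendered by the locale \<open>graph\<close>: finite loop-free digraphs
  without parallel arcs whose arc relation is symmetric. An edge \<open>uv\<close> is thus the pair of arcs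
  \<open>u \<rightarrow> v\<close> and \<open>v \<rightarrow> u\<close>, so that \<open>out_degree G v\<close> is the degree of \<open>v\<close>.
\<close>

definition k_connected :: "nat \<Rightarrow> ('a,'b) pre_digraph \<Rightarrow> bool" where
  "k_connected k G \<longleftrightarrow> k < card (verts G) \<and>
     (\<forall>X \<subseteq> verts G. finite X \<and> card X < k \<longrightarrow> connected (G \<restriction> (verts G - X)))"

text \<open>
  The bound on the length excludes the walks \<open>u, v, u\<close>, which are cycles of a symmetric digraph
  but not of the undirected graph it represents.
\<close>
definition hamiltonian :: "('a,'b) pre_digraph \<Rightarrow> bool" where
  "hamiltonian G \<longleftrightarrow>
     (\<exists>p. pre_digraph.cycle G p \<and> 3 \<le> length p \<and> tail G ` set p = verts G)"

definition claw_o_heavy :: "('a,'b) pre_digraph \<Rightarrow> bool" where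
  "claw_o_heavy G \<longleftrightarrow>
     (\<forall>H. induced_subgraph H G \<and> K\<^bsub>1,3\<^esub> H \<longrightarrow>
       (\<exists>u \<in> verts H. \<exists>v \<in> verts H. u \<noteq> v \<and> \<not> u \<rightarrow>\<^bsub>G\<^esub> v \<and>
          out_degree G u + out_degree G v \<ge> card (verts G)))"

definition induced_path :: "('a,'b) pre_digraph \<Rightarrow> 'a list \<Rightarrow> bool" where
  "induced_path G p \<longleftrightarrow> vpath p G \<and>
     arcs_ends (G \<restriction> set p) = set (vwalk_arcs p) \<union> (set (vwalk_arcs p))\<inverse>"

end

theory Submission
  imports Defs
begin

text \<open>
  Call two vertices \<open>F\<close>-adjacent if they are adjacent or have degree sum at least \<open>n\<close>. By the
  Bondy--Chvatal argument some cycle \<open>C\<close> of \<open>G\<close> is at least as long as every cycle of \<open>F\<close>-edges.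
  Suppose \<open>C\<close> is not spanning. By 2-connectedness there are \<open>w\<^sub>1 \<noteq> w\<^sub>2\<close> on \<open>C\<close> joined
  through a shortest path \<open>x\<^sub>1 \<dots> x\<^sub>r\<close> off \<open>C\<close> (or directly by an edge). By maximality of \<open>C\<close> and the
  condition on claws, the two neighbours of \<open>w\<^sub>i\<close> on \<open>C\<close> are \<open>F\<close>-adjacent.
  Following \<open>C\<close> in one direction, let \<open>y\<^sub>i\<close> be the first vertex after \<open>w\<^sub>i\<close> that is not adjacent
  to \<open>w\<^sub>i\<close>, and \<open>a\<^sub>i\<close> its predecessor. Rerouting \<open>C\<close> shows that \<open>w\<^sub>1, a\<^sub>1, y\<^sub>1\<close> have no
  \<open>F\<close>-neighbours among \<open>w\<^sub>2, a\<^sub>2, y\<^sub>2\<close>, except possibly for \<open>w\<^sub>1 w\<^sub>2\<close>, and that \<open>a\<^sub>i, y\<^sub>i\<close> have none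
  among the \<open>x\<^sub>j\<close>. Counting neighbours along \<open>C\<close> yields \<open>d(w\<^sub>1) + d(w\<^sub>2) < n\<close> and
  \<open>d(w\<^sub>1) + d(x\<^sub>j) < n\<close>. Hence the first six vertices of \<open>y\<^sub>1 a\<^sub>1 w\<^sub>1 x\<^sub>1 \<dots> x\<^sub>r w\<^sub>2 a\<^sub>2 y\<^sub>2\<close> form an
  induced path that violates the hypothesis.
\<close>

section \<open>Cycles and heavy pairs\<close>

text \<open>The relation is a parameter so that one notion covers cycles of edges, of
  \<open>F\<close>-edges and of the intermediate relations met while heavy pairs are removed one by
  one.\<close>

definition cyc :: "'a set \<Rightarrow> ('a \<Rightarrow> 'a \<Rightarrow> bool) \<Rightarrow> 'a list \<Rightarrow> bool" where
  "cyc V R xs \<longleftrightarrow> 3 \<le> length xs \<and> distinct xs \<and> set xs \<subseteq> V \<and>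
     successively R xs \<and> R (last xs) (hd xs)"

lemma cyc_append_commute: "cyc V R (xs @ ys) \<Longrightarrow> cyc V R (ys @ xs)"
  by (cases "xs = []"; cases "ys = []") (auto simp: cyc_def successively_append_iff)

lemma cyc_rev:
  assumes "cyc V R xs" "\<And>u v. R u v \<Longrightarrow> R v u"
  shows "cyc V R (rev xs)"
proof -
  have "successively (\<lambda>x y. R y x) xs"
    using assms by (auto simp: cyc_def elim: successively_mono)
  moreover have "xs \<noteq> []" using assms(1) by (auto simp: cyc_def)
  ultimately show ?thesis using assms by (auto simp: cyc_def last_rev hd_rev)
qed

lemma cyc_length_le: "finite V \<Longrightarrow> cyc V R xs \<Longrightarrow> length xs \<le> card V"
  by (metis card_mono cyc_def distinct_card)

lemma card_filter_set_nth:
  assumes "distinct xs"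
  shows "card {v \<in> set xs. P v} = card {i. i < length xs \<and> P (xs ! i)}"
proof -
  have "bij_betw ((!) xs) {i. i < length xs \<and> P (xs ! i)} {v \<in> set xs. P v}"
    using assms by (auto simp: bij_betw_def inj_on_def nth_eq_iff_index_eq in_set_conv_nth)
  then show ?thesis by (metis bij_betw_same_card)
qed

section \<open>Heavy pairs and the Bondy--Chvatal argument\<close>

locale simple_graph =
  fixes V :: "'a set" and E :: "'a \<Rightarrow> 'a \<Rightarrow> bool"
  assumes finite_V: "finite V"
    and E_sym: "E u v \<Longrightarrow> E v u"
    and E_irrefl: "\<not> E u u"
    and E_V: "E u v \<Longrightarrow> u \<in> V"
begin

definition deg :: "'a \<Rightarrow> nat" where
  "deg v = card {u. E v u}"

text \<open>Degrees are always those of the given graph, so \<open>F\<close> is a single step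
  towards the Bondy--Chvatal closure, not the iterated closure.\<close>

definition F :: "'a \<Rightarrow> 'a \<Rightarrow> bool" where
  "F u v \<longleftrightarrow> u \<noteq> v \<and> u \<in> V \<and> v \<in> V \<and> (E u v \<or> card V \<le> deg u + deg v)"

lemma E_V2: "E u v \<Longrightarrow> v \<in> V"
  by (blast dest: E_V E_sym)

lemma E_F: "E u v \<Longrightarrow> F u v"
  unfolding F_def using E_V E_V2 E_irrefl by blast

lemma F_sym: "F u v \<Longrightarrow> F v u"
  unfolding F_def by (metis E_sym add.commute)

lemma finite_nbrs: "finite {u. E v u}"
  by (rule finite_subset[OF _ finite_V]) (auto dest: E_V2)

text \<open>This is Ore's crossing argument. A common neighbour of the two ends off the path closes
  it directly. Otherwise their neighbours off the path are disjoint, so enough neighbours lie on the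
  path for the pigeonhole principle to give consecutive vertices \<open>xs ! i\<close> and
  \<open>xs ! Suc i\<close> adjacent to the last and to the first vertex respectively; reversing the
  part after \<open>xs ! i\<close> closes the path.\<close>

lemma heavy_path_closes:
  assumes H: "\<And>u v. H u v \<Longrightarrow> H v u" "\<And>u v. E u v \<Longrightarrow> H u v"
    and xs: "3 \<le> length xs" "distinct xs" "set xs \<subseteq> V" "successively H xs"
    and heavy: "card V \<le> deg (hd xs) + deg (last xs)"
  shows "\<exists>ys. cyc V H ys \<and> length xs \<le> length ys"
proof (cases "\<exists>z. z \<notin> set xs \<and> E (hd xs) z \<and> E (last xs) z")
  case True
  then obtain z where z: "z \<notin> set xs" "E (hd xs) z" "E (last xs) z" by blast
  then have "cyc V H (z # xs)"
    using xs H(2) E_sym[OF z(2)] E_V2[OF z(2)] E_sym[OF z(3)] z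
    by (auto simp: cyc_def successively_Cons)
  then show ?thesis by (intro exI[of _ "z # xs"]) simp
next
  case False
  let ?m = "length xs" and ?u = "hd xs" and ?v = "last xs"
  have ne: "xs \<noteq> []" using xs by auto
  define A where "A = {i. i < ?m \<and> E ?u (xs ! i)}"
  define B where "B = {i. i < ?m \<and> E ?v (xs ! i)}"
  have u0: "?u = xs ! 0" and vl: "?v = xs ! (?m - 1)"
    using ne by (simp_all add: hd_conv_nth last_conv_nth)
  have fin: "finite A" "finite B" by (auto simp: A_def B_def)
  have A0: "0 \<notin> A" using u0 E_irrefl by (auto simp: A_def)
  have Bl: "?m - 1 \<notin> B" using vl E_irrefl by (auto simp: B_def)
  have du: "deg ?u = card A + card ({u. E ?u u} - set xs)"
    and dv: "deg ?v = card B + card ({u. E ?v u} - set xs)"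
  proof -
    have "deg w = card {i. i < ?m \<and> E w (xs ! i)} + card ({u. E w u} - set xs)" for w
    proof -
      have "deg w = card ({v \<in> set xs. E w v} \<union> ({u. E w u} - set xs))"
        unfolding deg_def by (rule arg_cong[of _ _ card]) auto
      also have "\<dots> = card {v \<in> set xs. E w v} + card ({u. E w u} - set xs)"
        by (rule card_Un_disjoint) (use finite_nbrs in auto)
      finally show ?thesis by (simp add: card_filter_set_nth[OF xs(2)])
    qed
    then show "deg ?u = card A + card ({u. E ?u u} - set xs)"
      "deg ?v = card B + card ({u. E ?v u} - set xs)" by (simp_all add: A_def B_def)
  qed
  have "card ({u. E ?u u} - set xs) + card ({u. E ?v u} - set xs)
      = card (({u. E ?u u} - set xs) \<union> ({u. E ?v u} - set xs))"
    by (rule card_Un_disjoint[symmetric]) (use finite_nbrs False in auto)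
  also have "\<dots> \<le> card (V - set xs)"
    by (rule card_mono) (use finite_V in \<open>auto dest: E_V2\<close>)
  also have "\<dots> = card V - ?m"
    using xs by (simp add: card_Diff_subset distinct_card)
  finally have out: "card ({u. E ?u u} - set xs) + card ({u. E ?v u} - set xs) \<le> card V - ?m" .
  have mV: "?m \<le> card V" using xs finite_V by (metis card_mono distinct_card)
  \<comment> \<open>Disjointness would put at least \<open>?m\<close> indices into
    \<open>{1..<?m}\<close>. Neither end is its own neighbour, which keeps \<open>0\<close> out of
    \<open>A\<close> and \<open>?m\<close> out of the shifted \<open>B\<close>.\<close>
  have "A \<inter> Suc ` B \<noteq> {}"
  proof
    assume dis: "A \<inter> Suc ` B = {}"
    have "card A + card B = card (A \<union> Suc ` B)"
      using dis fin by (simp add: card_Un_disjoint card_image)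
    also have "\<dots> \<le> card {1..<?m}"
    proof (rule card_mono)
      show "A \<union> Suc ` B \<subseteq> {1..<?m}"
      proof
        fix i assume "i \<in> A \<union> Suc ` B"
        then show "i \<in> {1..<?m}"
        proof
          assume "i \<in> A"
          then show ?thesis using A0 by (cases i) (auto simp: A_def)
        next
          assume "i \<in> Suc ` B"
          then obtain j where "i = Suc j" "j \<in> B" by blast
          then show ?thesis using Bl by (cases "j = ?m - 1") (auto simp: B_def)
        qed
      qed
    qed simp
    finally have "card A + card B \<le> ?m - 1" by simp
    then show False using du dv out heavy mV xs(1) by linarith
  qed
  then obtain i where i: "Suc i < ?m" "E ?u (xs ! Suc i)" "E ?v (xs ! i)"
    by (auto simp: A_def B_def)
  define X Y where "X = take (Suc i) xs" and "Y = drop (Suc i) xs"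
  have XY: "xs = X @ Y" "X \<noteq> []" "Y \<noteq> []" using i ne by (auto simp: X_def Y_def)
  have "last X = xs ! i" "hd Y = xs ! Suc i"
    using i by (auto simp: X_def Y_def hd_drop_conv_nth take_Suc_conv_app_nth)
  then have jn: "H (hd X) (hd Y)" "H (last X) (last Y)" using i XY H by auto
  have "successively (\<lambda>a b. H b a) Y"
    using xs(4) H(1) unfolding XY(1) by (auto simp: successively_append_iff elim: successively_mono)
  then have "cyc V H (X @ rev Y)"
    using xs(1-4) XY jn(2) H(1)[OF jn(1)] unfolding cyc_def
    by (auto simp: successively_append_iff hd_rev last_rev)
  then show ?thesis by (intro exI[of _ "X @ rev Y"]) (simp add: XY(1))
qed

text \<open>A cycle using the pair is rotated so that the pair closes it. At least three distinct
  vertices in cyclic order use the pair only once, so what remains is an \<open>H\<close>-path with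
  heavy ends, to which \<open>heavy_path_closes\<close> applies.\<close>

lemma cyc_remove_heavy_pair:
  assumes H: "\<And>u v. H u v \<Longrightarrow> H v u" "\<And>u v. E u v \<Longrightarrow> H u v"
    and heavy: "card V \<le> deg u + deg v"
    and xs: "cyc V (\<lambda>a b. H a b \<or> {a, b} = {u, v}) xs"
  shows "\<exists>ys. cyc V H ys \<and> length xs \<le> length ys"
proof (cases "cyc V H xs")
  case False
  let ?R = "\<lambda>a b. H a b \<or> {a, b} = {u, v}"
  have "\<exists>ys. cyc V ?R ys \<and> length ys = length xs \<and> \<not> H (last ys) (hd ys)"
  proof (cases "H (last xs) (hd xs)")
    case True
    then have "\<not> successively H xs" using False xs by (auto simp: cyc_def)
    then obtain i where i: "Suc i < length xs" "\<not> H (xs ! i) (xs ! Suc i)"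
      by (auto simp: successively_conv_nth)
    let ?ys = "drop (Suc i) xs @ take (Suc i) xs"
    have "cyc V ?R ?ys" using cyc_append_commute[of V ?R "take (Suc i) xs" "drop (Suc i) xs"] xs by simp
    moreover have "last ?ys = xs ! i" "hd ?ys = xs ! Suc i"
      using i by (auto simp: hd_drop_conv_nth take_Suc_conv_app_nth)
    ultimately show ?thesis using i by (intro exI[of _ ?ys]) auto
  qed (use xs in blast)
  then obtain ys where ys: "cyc V ?R ys" "length ys = length xs" "\<not> H (last ys) (hd ys)" by blast
  then have uv: "{last ys, hd ys} = {u, v}" by (auto simp: cyc_def)
  have m: "3 \<le> length ys" "distinct ys" using ys by (auto simp: cyc_def)
  have sR: "successively ?R ys" using ys(1) by (simp add: cyc_def)
  have "successively H ys"
    unfolding successively_conv_nth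
  proof (intro allI impI)
    fix i assume i: "Suc i < length ys"
    show "H (ys ! i) (ys ! Suc i)"
    proof (rule ccontr)
      assume "\<not> ?thesis"
      then have "{ys ! i, ys ! Suc i} = {u, v}"
        using successively_nth[OF sR i] by blast
      then have "{ys ! i, ys ! Suc i} = {ys ! (length ys - 1), ys ! 0}"
        using uv m by (metis hd_conv_nth last_conv_nth list.size(3) not_numeral_le_zero)
      moreover have "ys \<noteq> []" using m by auto
      ultimately show False
        using m i by (auto simp: doubleton_eq_iff nth_eq_iff_index_eq)
    qed
  qed
  moreover have "card V \<le> deg (hd ys) + deg (last ys)"
    using heavy uv by (auto simp: doubleton_eq_iff)
  ultimately show ?thesis
    using heavy_path_closes[of H ys] H ys by (auto simp: cyc_def)
qed blast

text \<open>The heavy pairs are removed one at a time, by induction on the finite set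
  \<open>S\<close> of extra pairs; no step shortens the cycle.\<close>

lemma cyc_F_imp_cyc_E:
  assumes "cyc V F xs"
  shows "\<exists>ys. cyc V E ys \<and> length xs \<le> length ys"
proof -
  define P where "P = {(u, v). F u v}"
  have finP: "finite P"
    by (rule finite_subset[of _ "V \<times> V"]) (auto simp: P_def F_def finite_V)
  have main: "\<exists>ys. cyc V E ys \<and> length xs \<le> length ys"
    if "finite S" "S \<subseteq> P" "cyc V (\<lambda>a b. E a b \<or> (a, b) \<in> S \<or> (b, a) \<in> S) xs" for S xs
    using that
  proof (induction S arbitrary: xs rule: finite_induct)
    case empty
    then show ?case by auto
  next
    case (insert p S)
    obtain u v where p: "p = (u, v)" by force
    show ?case
    proof (cases "E u v")
      case True
      have "(\<lambda>a b. E a b \<or> (a, b) \<in> insert p S \<or> (b, a) \<in> insert p S)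
        = (\<lambda>a b. E a b \<or> (a, b) \<in> S \<or> (b, a) \<in> S)"
        using True E_sym[OF True] by (auto simp: p fun_eq_iff)
      then show ?thesis using insert by simp
    next
      case False
      then have hv: "card V \<le> deg u + deg v"
        using insert.prems by (auto simp: p P_def F_def)
      have "(\<lambda>a b. E a b \<or> (a, b) \<in> insert p S \<or> (b, a) \<in> insert p S)
        = (\<lambda>a b. (E a b \<or> (a, b) \<in> S \<or> (b, a) \<in> S) \<or> {a, b} = {u, v})"
        by (auto simp: p fun_eq_iff doubleton_eq_iff)
      then obtain ys where ys: "cyc V (\<lambda>a b. E a b \<or> (a, b) \<in> S \<or> (b, a) \<in> S) ys"
        "length xs \<le> length ys"
        using cyc_remove_heavy_pair[of "\<lambda>a b. E a b \<or> (a, b) \<in> S \<or> (b, a) \<in> S" u v xs]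
          insert.prems hv E_sym by fastforce
      obtain zs where "cyc V E zs" "length ys \<le> length zs"
        using insert.IH[OF _ ys(1)] insert.prems(1) by blast
      then show ?thesis using ys(2) by (meson order_trans)
    qed
  qed
  have "(\<lambda>a b. E a b \<or> (a, b) \<in> P \<or> (b, a) \<in> P) = F"
    unfolding P_def fun_eq_iff using E_F F_sym by blast
  then show ?thesis using main[of P xs] finP assms by auto
qed

text \<open>The cycle consists of edges but is compared with all \<open>F\<close>-cycles. Hence a
  rerouting may use \<open>F\<close>-edges freely, while consecutive vertices of \<open>C\<close>
  are truly adjacent, as the claw condition requires.\<close>

definition longest :: "'a list \<Rightarrow> bool" where
  "longest C \<longleftrightarrow> cyc V E C \<and> (\<forall>xs. cyc V F xs \<longrightarrow> length xs \<le> length C)"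

lemma longest_exists:
  assumes "cyc V E C0"
  obtains C where "longest C"
proof -
  have "\<exists>C. cyc V E C \<and> (\<forall>xs. cyc V E xs \<longrightarrow> length xs \<le> length C)"
    using ex_has_greatest_nat[of "cyc V E" C0 length "Suc (card V)"] assms
      cyc_length_le[OF finite_V] by (auto simp: less_Suc_eq_le)
  then obtain C where C: "cyc V E C" "\<And>xs. cyc V E xs \<Longrightarrow> length xs \<le> length C" by blast
  then have "longest C"
    using cyc_F_imp_cyc_E by (meson longest_def order_trans)
  then show thesis using that by blast
qed

end

section \<open>Rerouting a longest cycle\<close>

context simple_graph begin

text \<open>The vertex \<open>w\<close> is kept out of the list and the far end is left free: it may
  be any vertex off the cycle or, with a further \<open>F\<close>-edge, lead back to the
  cycle.\<close>

definition out_path :: "'a list \<Rightarrow> 'a \<Rightarrow> 'a list \<Rightarrow> bool" where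
  "out_path C w ps \<longleftrightarrow> ps \<noteq> [] \<and> distinct ps \<and> set ps \<subseteq> V - set C \<and>
     successively F ps \<and> F w (hd ps)"

text \<open>A true edge is demanded, not just an \<open>F\<close>-edge, because it has to serve in a
  claw centred at \<open>w\<close>.\<close>

definition attached :: "'a list \<Rightarrow> 'a \<Rightarrow> bool" where
  "attached C w \<longleftrightarrow> (\<exists>x. E w x \<and> x \<notin> set C)"

lemma longest_cyc_E: "longest C \<Longrightarrow> cyc V E C"
  by (simp add: longest_def)

lemma longest_cyc_F: "longest C \<Longrightarrow> cyc V F C"
  unfolding longest_def cyc_def by (auto intro: E_F elim: successively_mono)

lemma longest_maximal: "longest C \<Longrightarrow> cyc V F xs \<Longrightarrow> length xs \<le> length C"
  by (simp add: longest_def)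

lemma no_longer_F_cycle:
  assumes "longest C" "successively F xs" "F (last xs) (hd xs)"
    and "distinct xs" "set xs \<subseteq> V" "length C < length xs"
  shows False
proof -
  have "3 \<le> length C" using assms(1) by (simp add: longest_def cyc_def)
  then have "cyc V F xs" using assms by (simp add: cyc_def)
  then show False using longest_maximal assms by fastforce
qed

lemma longest_append_commute: "longest (xs @ ys) \<Longrightarrow> longest (ys @ xs)"
  unfolding longest_def by (auto intro: cyc_append_commute)

lemma longest_rev: "longest C \<Longrightarrow> longest (rev C)"
  unfolding longest_def by (auto intro: cyc_rev E_sym)

lemma longest_Cons_rev: "longest (w # Q) \<Longrightarrow> longest (w # rev Q)"
  using longest_append_commute[of "rev Q" "[w]"] longest_rev[of "w # Q"] by simp

lemma out_path_rev:
  assumes "out_path C w ps" "F (last ps) w'"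
  shows "out_path C w' (rev ps)"
proof -
  have "successively (\<lambda>x y. F y x) ps"
    using assms by (auto simp: out_path_def intro: F_sym elim: successively_mono)
  then show ?thesis
    using assms by (auto simp: out_path_def hd_rev intro: F_sym)
qed

lemma out_path_cong: "set C = set C' \<Longrightarrow> out_path C w ps = out_path C' w ps"
  by (simp add: out_path_def)

lemma attached_cong: "set C = set C' \<Longrightarrow> attached C w = attached C' w"
  by (simp add: attached_def)

text \<open>Inserting \<open>x\<close> between \<open>w\<close> and its neighbour on the cycle would
  give a longer \<open>F\<close>-cycle.\<close>

lemma outside_not_F_next:
  assumes C: "longest (w # Q)" and x: "E w x" "x \<notin> set (w # Q)"
  shows "\<not> F x (hd Q)" "\<not> F x (last Q)"
proof -
  have c: "cyc V F (w # Q)" using C by (rule longest_cyc_F)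
  then have ne: "Q \<noteq> []" by (auto simp: cyc_def)
  have Fx: "F w x" using x E_F by blast
  have xV: "x \<in> V" using x E_V2 by blast
  show "\<not> F x (hd Q)"
  proof
    assume "F x (hd Q)"
    then have "cyc V F (w # x # Q)"
      using c ne Fx xV x by (auto simp: cyc_def successively_Cons)
    then show False using longest_maximal[OF C] by fastforce
  qed
  show "\<not> F x (last Q)"
  proof
    assume "F x (last Q)"
    then have "cyc V F (x # w # Q)"
      using c ne F_sym[OF Fx] F_sym[of x "last Q"] xV x by (auto simp: cyc_def successively_Cons)
    then show False using longest_maximal[OF C] by fastforce
  qed
qed

end

section \<open>Rerouting with the claw condition\<close>

locale claw_o_heavy_graph = simple_graph +
  assumes claw: "E w a \<Longrightarrow> E w b \<Longrightarrow> E w c \<Longrightarrow> distinct [a, b, c] \<Longrightarrow> F a b \<or> F a c \<or> F b c"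
begin

lemma cycle_neighbours:
  assumes C: "longest (w # Q)"
  shows "E w (hd Q)" "E w (last Q)" "hd Q \<noteq> last Q" "hd Q \<in> set Q" "last Q \<in> set Q" "2 \<le> length Q"
proof -
  have c: "cyc V E (w # Q)" using C by (rule longest_cyc_E)
  then show l: "2 \<le> length Q" by (auto simp: cyc_def)
  then have ne: "Q \<noteq> []" by auto
  show "E w (hd Q)" "E w (last Q)" using c ne E_sym by (auto simp: cyc_def successively_Cons)
  show "hd Q \<in> set Q" "last Q \<in> set Q" using ne by auto
  obtain a b R where "Q = a # b # R"
    using l by (cases Q; cases "tl Q") auto
  then show "hd Q \<noteq> last Q" using c by (auto simp: cyc_def)
qed

text \<open>In the star with centre \<open>w\<close> and leaves \<open>x\<close>,
  \<open>last Q\<close>, \<open>hd Q\<close>, the outer vertex \<open>x\<close> is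
  \<open>F\<close>-adjacent to neither of the others, so the claw condition leaves only this pair.
  The \<open>F\<close>-edge lets a rerouting bypass \<open>w\<close>.\<close>

lemma last_F_hd:
  assumes C: "longest (w # Q)" and "attached (w # Q) w"
  shows "F (last Q) (hd Q)"
proof -
  obtain x where x: "E w x" "x \<notin> set (w # Q)" using assms by (auto simp: attached_def)
  have "distinct [x, last Q, hd Q]"
    using x cycle_neighbours[OF C] by auto
  then show ?thesis
    using claw[of w x "last Q" "hd Q"] outside_not_F_next[OF C x] cycle_neighbours[OF C] x by blast
qed

lemma last_F_hd_inner:
  assumes C: "longest C" "C = w\<^sub>1 # Q @ w\<^sub>2 # Q'" and ne: "Q \<noteq> []" "Q' \<noteq> []"
    and att: "attached C w\<^sub>2"
  shows "F (last Q) (hd Q')"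
proof -
  let ?C = "w\<^sub>2 # Q' @ w\<^sub>1 # Q"
  have "longest ?C"
    using longest_append_commute[of "w\<^sub>1 # Q" "w\<^sub>2 # Q'"] C by simp
  moreover have "set ?C = set C" using C(2) by auto
  then have "attached ?C w\<^sub>2" using att attached_cong by blast
  ultimately have "F (last (Q' @ w\<^sub>1 # Q)) (hd (Q' @ w\<^sub>1 # Q))" by (rule last_F_hd)
  then show ?thesis using ne by simp
qed

text \<open>The same star argument with leaves \<open>x\<close>, \<open>y\<close> and
  \<open>hd Q\<close>. It makes the neighbours of \<open>w\<close> off the cycle an
  \<open>F\<close>-clique.\<close>

lemma outside_neighbours_F:
  assumes C: "longest (w # Q)" and x: "E w x" "x \<notin> set (w # Q)"
    and y: "E w y" "y \<notin> set (w # Q)" and ne: "x \<noteq> y"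
  shows "F x y"
proof -
  have "distinct [x, y, hd Q]"
    using x y ne cycle_neighbours[OF C] by auto
  then show ?thesis
    using claw[of w x y "hd Q"] outside_not_F_next[OF C] cycle_neighbours[OF C] x y by blast
qed

text \<open>
  The segment \<open>K\<close> is sacrificed: the new cycle misses it but picks up the longer path \<open>ps\<close>.
\<close>

lemma not_F_after_outside:
  assumes C: "longest C" "C = w # J @ K @ z # T" and att: "attached C w"
    and J: "J = [] \<or> E w (last J)"
    and ps: "out_path C w ps" and K: "length K < length ps"
  shows "\<not> F (last ps) z"
proof
  assume Fz: "F (last ps) z"
  have c: "cyc V F C" using C(1) by (rule longest_cyc_F)
  \<comment> \<open>The new cycle is \<open>w\<close>, \<open>ps\<close>, \<open>z # T\<close>,
    \<open>J\<close>. The block \<open>J\<close> is moved to the end: it is entered by the bypass of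
    \<open>w\<close> and left through the edge from \<open>last J\<close> to
    \<open>w\<close>.\<close>
  have "J \<noteq> [] \<Longrightarrow> F (last (z # T)) (hd J)"
    using last_F_hd[of w "J @ K @ z # T"] C att by auto
  moreover have "J \<noteq> [] \<Longrightarrow> F (last J) w"
    using J E_F E_sym by blast
  moreover have "successively F J" "successively F (z # T)" "F (last (z # T)) w"
    using c unfolding cyc_def C(2) by (auto simp: successively_append_iff successively_Cons)
  ultimately have "successively F (w # ps @ (z # T) @ J)"
    "F (last (w # ps @ (z # T) @ J)) (hd (w # ps @ (z # T) @ J))"
    using ps Fz
    by (cases "J = []"; cases "T = []"; simp add: out_path_def successively_append_iff successively_Cons)+
  moreover have "distinct (w # ps @ (z # T) @ J)" "set (w # ps @ (z # T) @ J) \<subseteq> V"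
    "length C < length (w # ps @ (z # T) @ J)"
    using c ps K unfolding cyc_def out_path_def C(2) by auto
  ultimately show False by (rule no_longer_F_cycle[OF C(1)])
qed

text \<open>Each failure would let \<open>ps\<close> be inserted without losing a vertex, by
  \<open>not_F_after_outside\<close> with empty \<open>K\<close>; for \<open>Q'\<close> this is read
  on the reversed cycle.\<close>

lemma two_ends:
  assumes C: "longest C" "C = w\<^sub>1 # Q @ w\<^sub>2 # Q'"
    and att: "attached C w\<^sub>1"
    and ps: "out_path C w\<^sub>1 ps" "F (last ps) w\<^sub>2"
  shows "Q \<noteq> []" "Q' \<noteq> []" "\<not> E w\<^sub>1 (last Q)"
proof -
  have l: "0 < length ps" using ps by (auto simp: out_path_def)
  show "Q \<noteq> []"
    using not_F_after_outside[of C w\<^sub>1 "[]" "[]" w\<^sub>2 Q', OF C(1) _ att _ ps(1)] ps l C(2) by auto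
  show "\<not> E w\<^sub>1 (last Q)"
    using not_F_after_outside[of C w\<^sub>1 "Q" "[]" w\<^sub>2 Q', OF C(1) _ att _ ps(1)] ps l C(2) by auto
  show "Q' \<noteq> []"
  proof
    assume "Q' = []"
    let ?C = "w\<^sub>1 # w\<^sub>2 # rev Q"
    have s: "set C = set ?C" using C(2) \<open>Q' = []\<close> by auto
    have "longest ?C"
      using longest_Cons_rev[of w\<^sub>1 "Q @ [w\<^sub>2]"] C \<open>Q' = []\<close> by simp
    moreover have "out_path ?C w\<^sub>1 ps" using ps(1) out_path_cong[OF s] by blast
    moreover have "attached ?C w\<^sub>1" using att attached_cong[OF s] by blast
    ultimately have "\<not> F (last ps) w\<^sub>2"
      by (intro not_F_after_outside[of ?C w\<^sub>1 "[]" "[]" w\<^sub>2 "rev Q"]) (use l in simp_all)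
    then show False using ps(2) by blast
  qed
qed

text \<open>Otherwise \<open>w\<^sub>1\<close>, \<open>ps\<close>, \<open>w\<^sub>2\<close>,
  \<open>z # S\<close>, \<open>Q'\<close>, \<open>J\<close> is a cycle that trades \<open>K\<close>
  for the longer \<open>ps\<close>. It passes from \<open>z # S\<close> to \<open>Q'\<close> by the
  bypass of \<open>w\<^sub>2\<close> and from \<open>Q'\<close> to \<open>J\<close> by that of
  \<open>w\<^sub>1\<close>.\<close>

lemma not_F_second_end:
  assumes C: "longest C" "C = w\<^sub>1 # J @ K @ (z # S) @ w\<^sub>2 # Q'"
    and att: "attached C w\<^sub>1" "attached C w\<^sub>2"
    and J: "J = [] \<or> E w\<^sub>1 (last J)"
    and ps: "out_path C w\<^sub>1 ps" "F (last ps) w\<^sub>2" and K: "length K < length ps"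
  shows "\<not> F w\<^sub>2 z"
proof
  assume Fz: "F w\<^sub>2 z"
  have c: "cyc V F C" using C(1) by (rule longest_cyc_F)
  have Q': "Q' \<noteq> []"
    using two_ends(2)[OF C(1) _ att(1) ps, of "J @ K @ z # S" Q'] C(2) by simp
  have f2: "F (last (z # S)) (hd Q')"
    using last_F_hd_inner[OF C(1) _ _ Q' att(2), of w\<^sub>1 "J @ K @ z # S"] C(2) by simp
  have "J \<noteq> [] \<Longrightarrow> F (last Q') (hd J)"
    using last_F_hd[of w\<^sub>1 "J @ K @ (z # S) @ w\<^sub>2 # Q'"] C att Q' by auto
  moreover have "J \<noteq> [] \<Longrightarrow> F (last J) w\<^sub>1"
    using J E_F E_sym by blast
  moreover have "successively F J" "successively F (z # S)" "successively F Q'" "F (last Q') w\<^sub>1"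
    using c Q' unfolding cyc_def C(2) by (auto simp: successively_append_iff successively_Cons)
  ultimately have "successively F (w\<^sub>1 # ps @ w\<^sub>2 # (z # S) @ Q' @ J)"
    "F (last (w\<^sub>1 # ps @ w\<^sub>2 # (z # S) @ Q' @ J)) (hd (w\<^sub>1 # ps @ w\<^sub>2 # (z # S) @ Q' @ J))"
    using ps Fz f2 Q'
    by (cases "J = []"; cases "S = []"; simp add: out_path_def successively_append_iff successively_Cons)+
  moreover have "distinct (w\<^sub>1 # ps @ w\<^sub>2 # (z # S) @ Q' @ J)"
    "set (w\<^sub>1 # ps @ w\<^sub>2 # (z # S) @ Q' @ J) \<subseteq> V"
    "length C < length (w\<^sub>1 # ps @ w\<^sub>2 # (z # S) @ Q' @ J)"
    using c ps K unfolding cyc_def out_path_def C(2) by auto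
  ultimately show False by (rule no_longer_F_cycle[OF C(1)])
qed

text \<open>Otherwise \<open>w\<^sub>1\<close>, \<open>ps\<close>, \<open>w\<^sub>2\<close>,
  \<open>rev L\<close>, \<open>rev (y\<^sub>1 # S)\<close>, \<open>y\<^sub>2 # T\<close>,
  \<open>J\<close> is a cycle through all of \<open>C\<close> and \<open>ps\<close>. The bypasses
  lead from \<open>hd L\<close> to the end of \<open>y\<^sub>1 # S\<close> and from the end of
  \<open>y\<^sub>2 # T\<close> to \<open>J\<close>.\<close>

lemma not_F_across:
  assumes C: "longest C" "C = w\<^sub>1 # J @ (y\<^sub>1 # S) @ w\<^sub>2 # L @ y\<^sub>2 # T"
    and att: "attached C w\<^sub>1" "attached C w\<^sub>2"
    and J: "J = [] \<or> E w\<^sub>1 (last J)" and L: "L = [] \<or> E w\<^sub>2 (last L)"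
    and ps: "out_path C w\<^sub>1 ps" "F (last ps) w\<^sub>2"
  shows "\<not> F y\<^sub>1 y\<^sub>2"
proof
  assume Fy: "F y\<^sub>1 y\<^sub>2"
  have c: "cyc V F C" using C(1) by (rule longest_cyc_F)
  have f2: "L \<noteq> [] \<Longrightarrow> F (hd L) (last (y\<^sub>1 # S))"
    using last_F_hd_inner[OF C(1) _ _ _ att(2), of w\<^sub>1 "J @ y\<^sub>1 # S" "L @ y\<^sub>2 # T"] C(2)
    by (auto intro: F_sym)
  define M U W where "M = rev L" and "U = rev (y\<^sub>1 # S)" and "W = y\<^sub>2 # T"
  let ?C = "w\<^sub>1 # ps @ w\<^sub>2 # M @ U @ W @ J"
  have sF: "successively F xs \<Longrightarrow> successively F (rev xs)" for xs
    by (auto intro: F_sym elim: successively_mono)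
  have "successively F L" "successively F (y\<^sub>1 # S)" "F (last (y\<^sub>1 # S)) w\<^sub>2"
    and c': "successively F J" "successively F W" "F (last W) w\<^sub>1"
    using c unfolding cyc_def C(2) W_def by (auto simp: successively_append_iff successively_Cons)
  then have c'': "successively F M" "successively F U" "F w\<^sub>2 (hd U)"
    unfolding hd_rev M_def U_def using sF F_sym by blast+
  have M1: "M \<noteq> [] \<Longrightarrow> F (last M) (hd U)"
    unfolding hd_rev last_rev M_def U_def by (rule f2) simp
  have M2: "M \<noteq> [] \<Longrightarrow> F w\<^sub>2 (hd M)"
    using L E_F by (auto simp: hd_rev M_def)
  have UW: "U \<noteq> []" "W \<noteq> []" "F (last U) (hd W)" using Fy by (simp_all add: U_def W_def)
  have J1: "J \<noteq> [] \<Longrightarrow> F (last W) (hd J)"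
    unfolding W_def
    using last_F_hd[of w\<^sub>1 "J @ (y\<^sub>1 # S) @ w\<^sub>2 # L @ y\<^sub>2 # T"] C att by auto
  have J2: "J \<noteq> [] \<Longrightarrow> F (last J) w\<^sub>1"
    using J E_F E_sym by blast
  have p: "ps \<noteq> []" "successively F ps" "F w\<^sub>1 (hd ps)" using ps by (simp_all add: out_path_def)
  have "successively F ?C"
    using p ps(2) c' c'' M1 M2 UW J1
    by (cases "M = []"; cases "J = []") (simp_all add: successively_append_iff successively_Cons)
  moreover have "F (last ?C) (hd ?C)"
    using c' UW J2 by (cases "J = []") simp_all
  moreover have "distinct ?C" "set ?C \<subseteq> V" "length C < length ?C"
    using c ps unfolding cyc_def out_path_def C(2) M_def U_def W_def by auto
  ultimately show False by (rule no_longer_F_cycle[OF C(1)])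
qed

end

section \<open>Degree sums\<close>

text \<open>Every index of \<open>A\<close> bars its successor from \<open>B\<close>, and the
  largest one, \<open>a\<close>, bars the whole block up to \<open>a + r\<close>. The barred indices
  and \<open>B\<close> are disjoint and fit into \<open>{1..<k}\<close>.\<close>

lemma card_forward_gaps:
  fixes A B :: "nat set"
  assumes A: "A \<subseteq> {..<k}" "0 \<in> A" and B: "B \<subseteq> {1..<k}"
    and gap: "\<And>i j. i \<in> A \<Longrightarrow> j \<in> B \<Longrightarrow> i < j \<Longrightarrow> i + r < j"
    and short: "\<And>i. i \<in> A \<Longrightarrow> i + r < k" and r: "1 \<le> r"
  shows "card A + card B + r \<le> k"
proof -
  have fin: "finite A" "finite B" using A B by (auto intro: finite_subset)
  define a where "a = Max A"
  have a: "a \<in> A" "\<And>i. i \<in> A \<Longrightarrow> i \<le> a"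
    using fin A by (auto simp: a_def intro: Max_in)
  define S where "S = Suc ` A \<union> {a + 2..a + r}"
  have "card S = card A + (r - 1)"
    unfolding S_def by (subst card_Un_disjoint) (use fin a in \<open>force simp: card_image\<close>)+
  moreover have "S \<inter> B = {}"
    using gap r a(1) by (force simp: S_def)
  moreover have "S \<union> B \<subseteq> {1..<k}"
    using B short r a(1) by (fastforce simp: S_def)
  then have "card (S \<union> B) \<le> k - 1"
    by (metis card_atLeastLessThan card_mono finite_atLeastLessThan)
  moreover have "finite S" using fin by (simp add: S_def)
  ultimately have "card A + (r - 1) + card B \<le> k - 1"
    using fin by (simp add: card_Un_disjoint)
  moreover have "0 < k" using A by auto
  ultimately show ?thesis using r by linarith
qed

text \<open>The roles are exchanged: every index of \<open>B\<close> bars its predecessor from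
  \<open>A\<close>, and the largest one, \<open>b\<close>, bars the \<open>s\<close> indices after
  it. This block lies below \<open>k - 1\<close> because \<open>k - 1\<close> is itself in
  \<open>A\<close>.\<close>

lemma card_backward_gaps:
  fixes A B :: "nat set"
  assumes A: "A \<subseteq> {..<k}" "k - 1 \<in> A" and B: "B \<subseteq> {1..<k - 1}" "B \<noteq> {}"
    and pred: "\<And>i. i \<in> A \<Longrightarrow> Suc i \<notin> B"
    and gap: "\<And>i j. i \<in> A \<Longrightarrow> j \<in> B \<Longrightarrow> j < i \<Longrightarrow> j + s < i"
  shows "card A + card B + s \<le> k"
proof -
  have fin: "finite A" "finite B" using A B by (auto intro: finite_subset)
  define b where "b = Max B"
  have b: "b \<in> B" "\<And>j. j \<in> B \<Longrightarrow> j \<le> b"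
    using fin B by (auto simp: b_def intro: Max_in)
  have bs: "b + s < k - 1" using gap[OF A(2) b(1)] b(1) B(1) by auto
  define S where "S = (\<lambda>j. j - 1) ` B \<union> {b + 1..b + s}"
  have "inj_on (\<lambda>j. j - 1) B"
  proof (rule inj_onI)
    fix x y assume "x \<in> B" "y \<in> B" "x - 1 = y - 1"
    moreover from this B(1) have "1 \<le> x" "1 \<le> y" by auto
    ultimately show "x = y" by linarith
  qed
  then have "card S = card B + s"
    unfolding S_def by (subst card_Un_disjoint) (use fin b in \<open>force simp: card_image\<close>)+
  moreover have "S \<inter> A = {}"
  proof (rule ccontr)
    assume "S \<inter> A \<noteq> {}"
    then obtain i where i: "i \<in> S" "i \<in> A" by blast
    show False
    proof (cases "i \<in> (\<lambda>j. j - 1) ` B")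
      case True
      then have "Suc i \<in> B" using B(1) by force
      then show ?thesis using pred i by blast
    next
      case False
      then have "b < i" "i \<le> b + s" using i by (auto simp: S_def)
      then show ?thesis using gap[OF i(2) b(1)] by linarith
    qed
  qed
  moreover have "S \<union> A \<subseteq> {..<k}"
    using A B(1) bs by (fastforce simp: S_def)
  then have "card (S \<union> A) \<le> k"
    by (metis card_lessThan card_mono finite_lessThan)
  moreover have "finite S" using fin by (simp add: S_def)
  ultimately show ?thesis
    using fin by (simp add: card_Un_disjoint)
qed

lemma split_between:
  assumes "i < j" "j < length xs"
  shows "xs = take (Suc i) xs @ take (j - Suc i) (drop (Suc i) xs) @ xs ! j # drop (Suc j) xs"
proof -
  have "drop j xs = xs ! j # drop (Suc j) xs" using assms by (simp add: Cons_nth_drop_Suc)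
  moreover have "drop j xs = drop (j - Suc i) (drop (Suc i) xs)" using assms by simp
  ultimately show ?thesis by (metis append_take_drop_id)
qed

lemma list_of_clique:
  assumes "finite X" "\<And>x y. x \<in> X \<Longrightarrow> y \<in> X \<Longrightarrow> x \<noteq> y \<Longrightarrow> R x y"
  obtains xs where "set xs = X" "distinct xs" "successively R xs"
proof -
  obtain xs where xs: "set xs = X" "distinct xs"
    using finite_distinct_list[OF assms(1)] by blast
  moreover have "successively R xs"
    unfolding successively_conv_nth
  proof (intro allI impI)
    fix i assume "Suc i < length xs"
    then show "R (xs ! i) (xs ! Suc i)"
      using xs assms(2) by (metis Suc_lessD n_not_Suc_n nth_eq_iff_index_eq nth_mem)
  qed
  ultimately show ?thesis using that by blast
qed

section \<open>Degree sum of two attachment vertices\<close>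

context claw_o_heavy_graph begin

text \<open>At least \<open>length ps\<close> vertices of \<open>Q\<close> lie between a neighbour
  of \<open>w\<^sub>1\<close> and a later neighbour of \<open>w\<^sub>2\<close>, by
  \<open>not_F_second_end\<close>, and between a neighbour of \<open>w\<^sub>1\<close> and
  \<open>w\<^sub>2\<close> itself, by \<open>not_F_after_outside\<close>. The rest is
  \<open>card_forward_gaps\<close>.\<close>

lemma card_nbrs_two_ends:
  assumes C: "longest C" "C = w\<^sub>1 # Q @ w\<^sub>2 # Q'"
    and att: "attached C w\<^sub>1" "attached C w\<^sub>2"
    and ps: "out_path C w\<^sub>1 ps" "F (last ps) w\<^sub>2"
  shows "card {i. i < length Q \<and> E w\<^sub>1 (Q ! i)} + card {i. i < length Q \<and> E w\<^sub>2 (Q ! i)} + length ps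
    \<le> length Q"
proof (rule card_forward_gaps)
  have ne: "Q \<noteq> []" "Q' \<noteq> []" using two_ends[OF C att(1) ps] by auto
  have l: "0 < length ps" using ps by (auto simp: out_path_def)
  then show "1 \<le> length ps" by linarith
  show "{i. i < length Q \<and> E w\<^sub>1 (Q ! i)} \<subseteq> {..<length Q}" by auto
  show "0 \<in> {i. i < length Q \<and> E w\<^sub>1 (Q ! i)}"
    using cycle_neighbours(1)[of w\<^sub>1 "Q @ w\<^sub>2 # Q'"] C ne
    by (simp add: hd_append flip: hd_conv_nth)
  show "{i. i < length Q \<and> E w\<^sub>2 (Q ! i)} \<subseteq> {1..<length Q}"
  proof
    fix j assume j: "j \<in> {i. i < length Q \<and> E w\<^sub>2 (Q ! i)}"
    have "j \<noteq> 0"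
    proof
      assume "j = 0"
      moreover have "\<not> F w\<^sub>2 (hd Q)"
        using not_F_second_end[of C w\<^sub>1 "[]" "[]" "hd Q" "tl Q" w\<^sub>2 Q' ps] C att ps ne l by simp
      ultimately show False using j ne E_F by (auto simp: hd_conv_nth)
    qed
    then show "j \<in> {1..<length Q}" using j by simp
  qed
next
  fix i assume i: "i \<in> {i. i < length Q \<and> E w\<^sub>1 (Q ! i)}"
  then have J: "E w\<^sub>1 (last (take (Suc i) Q))" by (simp add: take_Suc_conv_app_nth)
  show "i + length ps < length Q"
  proof (rule ccontr)
    assume "\<not> ?thesis"
    then have "length (drop (Suc i) Q) < length ps" using i by auto
    then show False
      using not_F_after_outside[of C w\<^sub>1 "take (Suc i) Q" "drop (Suc i) Q" w\<^sub>2 Q' ps] J C att ps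
      by simp
  qed
  fix j assume j: "j \<in> {i. i < length Q \<and> E w\<^sub>2 (Q ! i)}" and ij: "i < j"
  show "i + length ps < j"
  proof (rule ccontr)
    assume "\<not> ?thesis"
    then have "length (take (j - Suc i) (drop (Suc i) Q)) < length ps" using i ij by auto
    moreover have "C = w\<^sub>1 # take (Suc i) Q @ take (j - Suc i) (drop (Suc i) Q) @
        (Q ! j # drop (Suc j) Q) @ w\<^sub>2 # Q'"
      using split_between[OF ij, of Q] j C(2) by simp
    ultimately have "\<not> F w\<^sub>2 (Q ! j)"
      using not_F_second_end[OF C(1) _ att _ ps] J by blast
    then show False using j E_F by blast
  qed
qed

lemma deg_split:
  "deg w = card {v \<in> S. E w v} + card {v. E w v \<and> v \<notin> S}"
proof -
  have "deg w = card ({v \<in> S. E w v} \<union> {v. E w v \<and> v \<notin> S})"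
    unfolding deg_def by (rule arg_cong[of _ _ card]) auto
  also have "\<dots> = card {v \<in> S. E w v} + card {v. E w v \<and> v \<notin> S}"
    by (rule card_Un_disjoint) (auto intro: finite_subset[OF _ finite_nbrs[of w]])
  finally show ?thesis .
qed

lemma card_outside_nbrs:
  assumes "S \<subseteq> V"
  shows "card {v. E u v \<and> v \<notin> S} + card {v. E w v \<and> v \<notin> S}
    \<le> card (V - S) + card {v. E u v \<and> E w v \<and> v \<notin> S}"
proof -
  have fin: "finite {v. E z v \<and> v \<notin> S}" for z
    by (rule finite_subset[OF _ finite_nbrs[of z]]) auto
  have "card {v. E u v \<and> v \<notin> S} + card {v. E w v \<and> v \<notin> S}
    = card ({v. E u v \<and> v \<notin> S} \<union> {v. E w v \<and> v \<notin> S})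
      + card ({v. E u v \<and> v \<notin> S} \<inter> {v. E w v \<and> v \<notin> S})"
    by (rule card_Un_Int[OF fin fin])
  moreover have "card ({v. E u v \<and> v \<notin> S} \<union> {v. E w v \<and> v \<notin> S}) \<le> card (V - S)"
    by (rule card_mono) (use finite_V E_V2 in auto)
  moreover have "{v. E u v \<and> v \<notin> S} \<inter> {v. E w v \<and> v \<notin> S} = {v. E u v \<and> E w v \<and> v \<notin> S}"
    by auto
  ultimately show ?thesis by simp
qed

lemma deg_sum_two_ends:
  assumes C: "longest C" "C = w\<^sub>1 # Q @ w\<^sub>2 # Q'"
    and att: "attached C w\<^sub>1" "attached C w\<^sub>2"
    and ps: "out_path C w\<^sub>1 ps" "F (last ps) w\<^sub>2"
  shows "deg w\<^sub>1 + deg w\<^sub>2 < card V"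
proof -
  \<comment> \<open>The common neighbours off \<open>C\<close> form an \<open>F\<close>-clique, so a path from \<open>w\<^sub>1\<close> to \<open>w\<^sub>2\<close> can visit
    them all; the gaps it forces in \<open>Q\<close> and \<open>Q'\<close> outweigh counting them twice.\<close>
  define X where "X = {v. E w\<^sub>1 v \<and> E w\<^sub>2 v \<and> v \<notin> set C}"
  have finX: "finite X"
    unfolding X_def by (rule finite_subset[OF _ finite_nbrs[of w\<^sub>1]]) auto
  have c: "distinct C" "set C \<subseteq> V" using longest_cyc_E[OF C(1)] by (auto simp: cyc_def)
  have "\<exists>qs. out_path C w\<^sub>1 qs \<and> F (last qs) w\<^sub>2 \<and> card X \<le> length qs"
  proof (cases "X = {}")
    case False
    have "F x y" if "x \<in> X" "y \<in> X" "x \<noteq> y" for x y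
      using that outside_neighbours_F[of w\<^sub>1 "Q @ w\<^sub>2 # Q'" x y] C by (simp add: X_def)
    then obtain qs where qs: "set qs = X" "distinct qs" "successively F qs"
      using list_of_clique[OF finX, of F] by blast
    then have "qs \<noteq> []" using False by auto
    then have "hd qs \<in> X" "last qs \<in> X" using qs by auto
    then have "E w\<^sub>1 (hd qs)" "E w\<^sub>2 (last qs)" by (auto simp: X_def)
    then have "F w\<^sub>1 (hd qs)" "F (last qs) w\<^sub>2" using E_F E_sym by blast+
    moreover have "X \<subseteq> V - set C" using E_V2 by (auto simp: X_def)
    ultimately have "out_path C w\<^sub>1 qs" using qs \<open>qs \<noteq> []\<close> by (auto simp: out_path_def)
    moreover have "card X = length qs" using qs distinct_card by fastforce
    ultimately show ?thesis using \<open>F (last qs) w\<^sub>2\<close> by auto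
  qed (use ps in auto)
  then obtain qs where qs: "out_path C w\<^sub>1 qs" "F (last qs) w\<^sub>2" "card X \<le> length qs" by blast
  have qs1: "1 \<le> length qs" using qs(1) by (cases qs) (auto simp: out_path_def)
  have dQ: "distinct Q" "distinct Q'" using c(1) C(2) by auto
  define n where "n w Q = card {v \<in> set Q. E w v}" for w Q
  have Q: "n w\<^sub>1 Q + n w\<^sub>2 Q + length qs \<le> length Q"
    using card_nbrs_two_ends[OF C att qs(1,2)] dQ by (simp add: n_def card_filter_set_nth)
  \<comment> \<open>The other arc is handled on the reversed cycle, where \<open>rev Q'\<close> runs
    from \<open>w\<^sub>1\<close> to \<open>w\<^sub>2\<close>.\<close>
  have Q': "n w\<^sub>1 Q' + n w\<^sub>2 Q' + length qs \<le> length Q'"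
  proof -
    let ?C = "w\<^sub>1 # rev Q' @ w\<^sub>2 # rev Q"
    have "longest ?C" using longest_Cons_rev[of w\<^sub>1 "Q @ w\<^sub>2 # Q'"] C by simp
    moreover have s: "set ?C = set C" using C(2) by auto
    moreover have "attached ?C w\<^sub>1" "attached ?C w\<^sub>2" "out_path ?C w\<^sub>1 qs"
      using att qs(1) attached_cong[OF s] out_path_cong[OF s] by blast+
    ultimately have "card {i. i < length (rev Q') \<and> E w\<^sub>1 (rev Q' ! i)} +
        card {i. i < length (rev Q') \<and> E w\<^sub>2 (rev Q' ! i)} + length qs \<le> length (rev Q')"
      using card_nbrs_two_ends[OF _ refl _ _ _ qs(2)] by blast
    then show ?thesis
      using card_filter_set_nth[of "rev Q'"] dQ by (simp add: n_def)
  qed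
  \<comment> \<open>The \<open>+ 1\<close> allows for an edge between \<open>w\<^sub>1\<close> and
    \<open>w\<^sub>2\<close>.\<close>
  have on: "card {v \<in> set C. E w v} \<le> n w Q + n w Q' + 1"
    if "w = w\<^sub>1 \<and> u = w\<^sub>2 \<or> w = w\<^sub>2 \<and> u = w\<^sub>1" for w u
  proof -
    have "card {v \<in> set C. E w v} \<le> card (({v \<in> set Q. E w v} \<union> {v \<in> set Q'. E w v}) \<union> {u})"
      by (rule card_mono) (use that E_irrefl C(2) in auto)
    also have "\<dots> \<le> card ({v \<in> set Q. E w v} \<union> {v \<in> set Q'. E w v}) + card {u}"
      by (rule card_Un_le)
    also have "\<dots> \<le> n w Q + n w Q' + 1"
      unfolding n_def using card_Un_le[of "{v \<in> set Q. E w v}" "{v \<in> set Q'. E w v}"] by simp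
    finally show ?thesis .
  qed
  have "card (V - set C) = card V - length C" "length C \<le> card V"
    using c finite_V by (simp_all add: card_Diff_subset distinct_card) (metis card_mono distinct_card)
  moreover have "deg w\<^sub>1 + deg w\<^sub>2 \<le> card {v \<in> set C. E w\<^sub>1 v} + card {v \<in> set C. E w\<^sub>2 v}
      + card (V - set C) + card X"
    using deg_split[of w\<^sub>1 "set C"] deg_split[of w\<^sub>2 "set C"] card_outside_nbrs[OF c(2), of w\<^sub>1 w\<^sub>2]
    unfolding X_def by linarith
  moreover have "length C = length Q + length Q' + 2" by (simp add: C(2))
  moreover have "card {v \<in> set C. E w\<^sub>1 v} \<le> n w\<^sub>1 Q + n w\<^sub>1 Q' + 1"
    "card {v \<in> set C. E w\<^sub>2 v} \<le> n w\<^sub>2 Q + n w\<^sub>2 Q' + 1"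
    using on[of w\<^sub>1 w\<^sub>2] on[of w\<^sub>2 w\<^sub>1] by simp_all
  \<comment> \<open>On \<open>C\<close> the two vertices have at most
    \<open>length C - 2 * length qs\<close> neighbours in total, off \<open>C\<close> at most
    \<open>card V - length C + card X\<close>; here \<open>card X\<close> is at most
    \<open>length qs\<close>, which is positive.\<close>
  ultimately show ?thesis
    using Q Q' qs(3) qs1 by linarith
qed

end

section \<open>Shortest walks between vertex sets\<close>

context simple_graph begin

definition walk :: "'a set \<Rightarrow> 'a set \<Rightarrow> 'a set \<Rightarrow> 'a list \<Rightarrow> bool" where
  "walk D Z T ps \<longleftrightarrow> ps \<noteq> [] \<and> set ps \<subseteq> D \<and> successively E ps \<and> hd ps \<in> Z \<and> last ps \<in> T"

text \<open>In a walk of least length, a repeated vertex, a late visit to \<open>Z\<close>, an early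
  visit to \<open>T\<close> or a chord would each yield a shorter walk between the same
  sets.\<close>

lemma shortest_walk:
  assumes "walk D Z T qs"
  obtains ps where "walk D Z T ps" "distinct ps" "set (tl ps) \<inter> Z = {}" "set (butlast ps) \<inter> T = {}"
    "\<And>as x bs y cs. ps = as @ x # bs @ y # cs \<Longrightarrow> bs \<noteq> [] \<Longrightarrow> \<not> E x y"
proof -
  obtain ps where ps: "walk D Z T ps" and min: "\<And>qs. walk D Z T qs \<Longrightarrow> length ps \<le> length qs"
    using ex_has_least_nat[of "walk D Z T" qs length] assms by blast
  have "distinct ps"
  proof (rule ccontr)
    assume "\<not> distinct ps"
    then obtain xs y ys zs where d: "ps = xs @ [y] @ ys @ [y] @ zs"
      using not_distinct_decomp by blast
    then have "walk D Z T (xs @ y # zs)"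
      using ps by (auto simp: walk_def successively_append_iff successively_Cons hd_append
          split: if_splits)
    then show False using min d by fastforce
  qed
  moreover have "set (tl ps) \<inter> Z = {}"
  proof (rule ccontr)
    assume "set (tl ps) \<inter> Z \<noteq> {}"
    then obtain y where "y \<in> set (tl ps)" "y \<in> Z" by blast
    then obtain as bs where d: "tl ps = as @ y # bs" by (meson split_list)
    then obtain x where d': "ps = (x # as) @ y # bs" by (cases ps) auto
    then have "walk D Z T (y # bs)"
      using ps \<open>y \<in> Z\<close> unfolding walk_def d' successively_append_iff by simp
    then show False using min d' by fastforce
  qed
  moreover have "set (butlast ps) \<inter> T = {}"
  proof (rule ccontr)
    assume "set (butlast ps) \<inter> T \<noteq> {}"
    then obtain y where "y \<in> set (butlast ps)" "y \<in> T" by blast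
    then obtain as bs where d: "butlast ps = as @ y # bs" by (meson split_list)
    obtain z where "ps = butlast ps @ [z]" using ps by (metis append_butlast_last_id walk_def)
    then have d': "ps = as @ y # bs @ [z]" using d by simp
    then have d'': "ps = (as @ [y]) @ bs @ [z]" by simp
    then have "successively E (as @ [y])" "set (as @ [y]) \<subseteq> D"
      using ps unfolding walk_def by (metis successively_append_iff, metis Un_subset_iff set_append)
    moreover have "hd (as @ [y]) = hd ps" unfolding d'' by (cases as) simp_all
    ultimately have "walk D Z T (as @ [y])"
      using ps \<open>y \<in> T\<close> by (auto simp: walk_def)
    then show False using min[of "as @ [y]"] arg_cong[OF d', of length] by simp
  qed
  moreover have "\<not> E x y" if d: "ps = as @ x # bs @ y # cs" "bs \<noteq> []" for as x bs y cs
  proof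
    assume xy: "E x y"
    have d': "ps = (as @ [x]) @ bs @ (y # cs)" using d by simp
    have "set (as @ x # y # cs) \<subseteq> D" using ps d by (auto simp: walk_def)
    have "successively E (as @ [x])" "successively E (y # cs)"
      using ps unfolding walk_def d' successively_append_iff[of E "as @ [x]"]
        successively_append_iff[of E bs] by blast+
    then have "successively E ((as @ [x]) @ (y # cs))"
      using xy by (simp add: successively_append_iff)
    moreover have "hd (as @ x # y # cs) = hd ps" using d by (cases as) auto
    moreover have "last (as @ x # y # cs) = last ps" using d by simp
    ultimately have "walk D Z T (as @ x # y # cs)"
      using ps \<open>set (as @ x # y # cs) \<subseteq> D\<close> by (auto simp: walk_def)
    then show False using min[of "as @ x # y # cs"] d by (cases bs) auto
  qed
  ultimately show ?thesis using that ps by blast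
qed

lemma successively_E_F: "successively E xs \<Longrightarrow> successively F xs"
  by (auto intro: E_F elim: successively_mono)

lemma walk_rev: "walk D Z T ps \<Longrightarrow> walk D T Z (rev ps)"
proof -
  assume ps: "walk D Z T ps"
  then have "successively (\<lambda>x y. E y x) ps"
    by (auto simp: walk_def intro: E_sym elim: successively_mono)
  then show ?thesis using ps by (auto simp: walk_def hd_rev last_rev)
qed

end

section \<open>Degree sum of an attachment vertex and a vertex off the cycle\<close>

locale two_connected_claw_o_heavy = claw_o_heavy_graph +
  assumes connected_minus: "w \<in> V \<Longrightarrow> u \<in> V - {w} \<Longrightarrow> v \<in> V - {w} \<Longrightarrow>
    (\<lambda>a b. E a b \<and> a \<noteq> w \<and> b \<noteq> w)\<^sup>*\<^sup>* u v"
begin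

text \<open>With \<open>w\<close> deleted, \<open>x\<close> still reaches \<open>c\<close>; such a
  walk is cut at its first vertex in \<open>S\<close>, which becomes \<open>w'\<close>.\<close>

lemma exit_walk:
  assumes S: "S \<subseteq> V" and x: "x \<in> V - S" and w: "w \<in> S" and c: "c \<in> S" "c \<noteq> w"
  obtains ps w' where "walk (V - S) {x} {v. E v w'} ps" "w' \<in> S" "w' \<noteq> w"
proof -
  have "(\<lambda>a b. E a b \<and> a \<noteq> w \<and> b \<noteq> w)\<^sup>*\<^sup>* x c"
    using connected_minus[of w x c] assms by blast
  then have "\<exists>ps w'. walk (V - S) {x} {v. E v w'} ps \<and> w' \<in> S \<and> w' \<noteq> w"
    using x
  proof (induction rule: converse_rtranclp_induct)
    case base
    then show ?case using c by blast
  next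
    case (step x y)
    show ?case
    proof (cases "y \<in> S")
      case True
      then have "walk (V - S) {x} {v. E v y} [x]" using step by (simp add: walk_def)
      then show ?thesis using True step by blast
    next
      case False
      then have "y \<in> V - S" using step.hyps E_V2 by blast
      then obtain ps w' where "walk (V - S) {y} {v. E v w'} ps" "w' \<in> S" "w' \<noteq> w"
        using step.IH by blast
      moreover from this have "walk (V - S) {x} {v. E v w'} (x # ps)"
        using step by (auto simp: walk_def successively_Cons)
      ultimately show ?thesis by blast
    qed
  qed
  then show ?thesis using that by blast
qed

lemma deg_sum_outside:
  assumes C: "longest C" "C = w # Q" and att: "attached C w"
    and ps: "out_path C w ps" "last ps = x"
  shows "deg w + deg x < card V"
proof -
  have c: "distinct C" "set C \<subseteq> V" "w \<notin> set Q" using longest_cyc_E[OF C(1)] C(2) by (auto simp: cyc_def)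
  have ps1: "ps \<noteq> []" using ps by (simp add: out_path_def)
  then have x: "x \<in> V - set C" using ps last_in_set[of ps] by (auto simp: out_path_def)
  define k where "k = length Q"
  define A where "A = {i. i < k \<and> E w (Q ! i)}"
  define B where "B = {i. i < k \<and> E x (Q ! i)}"
  define X where "X = {v. E w v \<and> E x v \<and> v \<notin> set C}"
  \<comment> \<open>If \<open>x\<close> has neighbours on \<open>C\<close> other than \<open>w\<close>, a path from \<open>w\<close> through \<open>X\<close> to \<open>x\<close> forces gaps;
    otherwise a path from \<open>w\<close> through the \<open>F\<close>-clique \<open>Z\<close> back to \<open>C\<close> does.\<close>
  define Z where "Z = (if E w x then insert x X else X)"
  have finX: "finite X"
    unfolding X_def by (rule finite_subset[OF _ finite_nbrs[of w]]) auto
  then have finZ: "finite Z" by (simp add: Z_def)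
  have ZV: "Z \<subseteq> V - set C" and ZE: "\<And>z. z \<in> Z \<Longrightarrow> E w z"
    using x E_V2 by (auto simp: Z_def X_def split: if_splits)
  have FZ: "F y z" if "y \<in> Z" "z \<in> Z" "y \<noteq> z" for y z
    using outside_neighbours_F[of w Q y z] that C ZE ZV by auto
  have xX: "x \<notin> X" using E_irrefl by (simp add: X_def)
  have nb: "2 \<le> k" "0 \<in> A" "k - 1 \<in> A"
  proof -
    show "2 \<le> k" using cycle_neighbours[of w Q] C by (simp add: k_def)
    moreover from this have "Q \<noteq> []" by (auto simp: k_def)
    ultimately show "0 \<in> A" "k - 1 \<in> A"
      using cycle_neighbours(1,2)[of w Q] C by (simp_all add: A_def k_def hd_conv_nth last_conv_nth)
  qed
  have A: "A \<subseteq> {..<k}" and fin: "finite A" "finite B" by (auto simp: A_def B_def)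
  \<comment> \<open>Jumping to a position shortly after a neighbour of \<open>w\<close> skips fewer
    than \<open>length qs\<close> vertices, so \<open>not_F_after_outside\<close> applies;
    \<open>j = 0\<close> is the case of an empty block.\<close>
  have forward: "\<not> F (last qs) (Q ! j)"
    if qs: "out_path C w qs" and j: "j < k" "j = 0 \<or> (\<exists>i \<in> A. i < j \<and> j \<le> i + length qs)" for qs j
  proof -
    have l: "0 < length qs" using qs by (auto simp: out_path_def)
    show ?thesis
    proof (cases "j = 0")
      case True
      have "C = w # [] @ [] @ Q ! j # tl Q"
        using C(2) j True by (cases Q) (auto simp: k_def)
      then show ?thesis
        using not_F_after_outside[OF C(1) _ att _ qs, of "[]" "[]"] l by simp
    next
      case False
      then obtain i where i: "i \<in> A" "i < j" "j \<le> i + length qs" using j by blast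
      then have "E w (last (take (Suc i) Q))" by (simp add: take_Suc_conv_app_nth A_def k_def)
      moreover have "length (take (j - Suc i) (drop (Suc i) Q)) < length qs" using i by simp
      moreover have "C = w # take (Suc i) Q @ take (j - Suc i) (drop (Suc i) Q) @ Q ! j # drop (Suc j) Q"
        using split_between[OF i(2), of Q] j C(2) by (simp add: k_def)
      ultimately show ?thesis
        using not_F_after_outside[OF C(1) _ att _ qs] by blast
    qed
  qed
  \<comment> \<open>The mirror image of \<open>forward\<close>, read on the reversed cycle, where
    position \<open>j\<close> becomes \<open>k - 1 - j\<close>.\<close>
  have backward: "\<not> F (last qs) (Q ! j)"
    if qs: "out_path C w qs" and j: "j < k" "j = k - 1 \<or> (\<exists>i \<in> A. j < i \<and> i \<le> j + length qs)" for qs j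
  proof -
    let ?R = "rev Q" and ?C = "w # rev Q"
    have l: "0 < length qs" using qs by (auto simp: out_path_def)
    have C': "longest ?C" using longest_Cons_rev[of w Q] C by simp
    have s: "set ?C = set C" using C(2) by auto
    have att': "attached ?C w" and qs': "out_path ?C w qs"
      using att qs attached_cong[OF s] out_path_cong[OF s] by blast+
    define j' where "j' = k - 1 - j"
    have j': "?R ! j' = Q ! j" "j' < k" using j by (auto simp: j'_def rev_nth k_def)
    show ?thesis
    proof (cases "j = k - 1")
      case True
      have "?R ! 0 = Q ! j" "?R \<noteq> []" using j' True nb(1) by (auto simp: j'_def k_def)
      then have "?C = w # [] @ [] @ Q ! j # tl (rev Q)"
        by (metis append_Nil hd_conv_nth list.collapse)
      then show ?thesis
        using not_F_after_outside[OF C' _ att' _ qs', of "[]" "[]"] l by simp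
    next
      case False
      then obtain i where i: "i \<in> A" "j < i" "i \<le> j + length qs" using j by blast
      define i' where "i' = k - 1 - i"
      have ik: "i < k" using i by (simp add: A_def)
      then have i': "?R ! i' = Q ! i" "i' < j'" "j' \<le> i' + length qs" "i' < k"
        using i j by (auto simp: i'_def j'_def rev_nth k_def)
      then have "E w (last (take (Suc i') ?R))"
        using i by (simp add: take_Suc_conv_app_nth A_def k_def)
      moreover have "length (take (j' - Suc i') (drop (Suc i') ?R)) < length qs" using i' by simp
      moreover have "?C = w # take (Suc i') ?R @ take (j' - Suc i') (drop (Suc i') ?R) @ Q ! j # drop (Suc j') ?R"
        using split_between[OF i'(2), of ?R] j' by (simp add: k_def)
      ultimately show ?thesis
        using not_F_after_outside[OF C' _ att' _ qs'] by blast
    qed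
  qed
  have main: "card A + card B + card Z \<le> k"
  proof (cases "B = {}")
    case False
    have "\<exists>qs. out_path C w qs \<and> last qs = x \<and> card Z \<le> length qs"
    proof (cases "X = {}")
      \<comment> \<open>Without common neighbours off \<open>C\<close>, the set \<open>Z\<close> has
        at most one element, so the nonempty \<open>ps\<close> is long enough.\<close>
      case True
      then show ?thesis using ps ps1 by (cases ps) (auto simp: Z_def)
    next
      case False
      have "F y z" if "y \<in> X" "z \<in> X" "y \<noteq> z" for y z
        using FZ that by (simp add: Z_def)
      then obtain xs where xs: "set xs = X" "distinct xs" "successively F xs"
        using list_of_clique[OF finX, of F] by blast
      then have ne: "xs \<noteq> []" using False by auto
      then have "hd xs \<in> X" "last xs \<in> X" using xs by auto
      then have "F w (hd xs)" "F (last xs) x" using E_F E_sym by (auto simp: X_def)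
      moreover have "X \<subseteq> V - set C" using ZV by (auto simp: Z_def split: if_splits)
      ultimately have "out_path C w (xs @ [x])"
        using xs ne x xX by (auto simp: out_path_def successively_append_iff)
      moreover have "card X = length xs" using xs distinct_card by fastforce
      then have "card Z \<le> length (xs @ [x])"
        using finX xX by (simp add: Z_def)
      ultimately show ?thesis by (intro exI[of _ "xs @ [x]"]) simp
    qed
    then obtain qs where qs: "out_path C w qs" "last qs = x" "card Z \<le> length qs" by blast
    have l: "0 < length qs" using qs by (auto simp: out_path_def)
    have "card A + card B + length qs \<le> k"
    proof (rule card_backward_gaps[OF A nb(3)])
      show "B \<noteq> {}" by fact
      show "B \<subseteq> {1..<k - 1}"
      proof
        fix j assume j: "j \<in> B"
        then have "j < k" "F (last qs) (Q ! j)" using E_F qs(2) by (auto simp: B_def)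
        then have "j \<noteq> 0" using forward[OF qs(1), of j] by metis
        moreover have "j \<noteq> k - 1"
          using backward[OF qs(1), of j] \<open>j < k\<close> \<open>F (last qs) (Q ! j)\<close> by metis
        ultimately show "j \<in> {1..<k - 1}" using \<open>j < k\<close> by auto
      qed
    next
      fix i assume i: "i \<in> A"
      show "Suc i \<notin> B"
      proof
        assume "Suc i \<in> B"
        then have "Suc i < k" "F (last qs) (Q ! Suc i)" using E_F qs(2) by (auto simp: B_def)
        moreover have "Suc i \<le> i + length qs" using l by linarith
        ultimately show False using forward[OF qs(1), of "Suc i"] i by blast
      qed
      fix j assume j: "j \<in> B" "j < i"
      show "j + length qs < i"
      proof (rule ccontr)
        assume "\<not> ?thesis"
        moreover have "j < k" "F (last qs) (Q ! j)" using j E_F qs(2) by (auto simp: B_def)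
        ultimately show False using backward[OF qs(1), of j] i j by (auto simp: not_less)
      qed
    qed
    then show ?thesis using qs(3) by linarith
  next
    case True
    show ?thesis
    proof (cases "Z = {}")
      case True
      have "card A \<le> k" using A by (metis card_lessThan card_mono finite_lessThan)
      then show ?thesis using True \<open>B = {}\<close> by simp
    next
      case False
      then obtain z where z: "z \<in> Z" by blast
      have "hd Q \<in> set C" "hd Q \<noteq> w"
        using cycle_neighbours[of w Q] C c by auto
      moreover have "z \<in> V - set C" "w \<in> set C" using ZV z C(2) by auto
      ultimately obtain qs w\<^sub>2 where qs: "walk (V - set C) {z} {v. E v w\<^sub>2} qs"
        and w2: "w\<^sub>2 \<in> set C" "w\<^sub>2 \<noteq> w"
        using exit_walk[OF c(2), of z w "hd Q"] by blast
      then have "walk (V - set C) Z {v. E v w\<^sub>2} qs" using z by (auto simp: walk_def)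
      then obtain qs where qs: "walk (V - set C) Z {v. E v w\<^sub>2} qs" "distinct qs" "set (tl qs) \<inter> Z = {}"
        using shortest_walk by metis
      obtain zs where zs: "set zs = Z - {hd qs}" "distinct zs" "successively F zs"
        using list_of_clique[of "Z - {hd qs}" F] finZ FZ by auto
      \<comment> \<open>The path first visits the rest of the clique \<open>Z\<close> and leaves it
        for good at \<open>hd qs\<close>. Since the remainder of \<open>qs\<close> avoids
        \<open>Z\<close>, the two pieces are disjoint, and \<open>rs\<close> has at least
        \<open>card Z\<close> vertices.\<close>
      define rs where "rs = zs @ qs"
      have h: "qs \<noteq> []" "hd qs \<in> Z" "set qs \<subseteq> V - set C" "F (last qs) w\<^sub>2" "successively F qs"
        using qs E_F successively_E_F by (auto simp: walk_def)
      have "set qs = insert (hd qs) (set (tl qs))" using h(1) by (cases qs) auto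
      then have dis: "set zs \<inter> set qs = {}" using zs qs(3) by auto
      have "zs \<noteq> [] \<Longrightarrow> last zs \<in> Z - {hd qs} \<and> hd zs \<in> Z" using zs by (metis last_in_set hd_in_set DiffD1)
      then have "zs \<noteq> [] \<Longrightarrow> F (last zs) (hd qs) \<and> F w (hd zs)"
        using FZ h(2) ZE E_F by blast
      then have rs: "out_path C w rs" "F (last rs) w\<^sub>2"
        using h zs qs(2) dis ZV ZE[OF h(2)] E_F
        by (auto simp: out_path_def rs_def successively_append_iff hd_append)
      have "card Z = Suc (card (Z - {hd qs}))" using finZ h(2) by (metis card_Suc_Diff1)
      moreover have "card (Z - {hd qs}) = length zs" using zs distinct_card by metis
      moreover have "1 \<le> length qs" using h(1) by (cases qs) simp_all
      ultimately have len: "card Z \<le> length rs" by (simp add: rs_def)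
      obtain m where m: "m < k" "w\<^sub>2 = Q ! m"
        using w2 C(2) by (auto simp: in_set_conv_nth k_def)
      have gap: "\<not> (i < m \<and> m \<le> i + length rs)" if "i \<in> A" for i
        using forward[OF rs(1) m(1)] rs(2) m(2) that by blast
      have "m \<noteq> 0" using forward[OF rs(1) m(1)] rs(2) m(2) by metis
      then have mr: "length rs < m" using gap[OF nb(2)] by auto
      \<comment> \<open>As \<open>rs\<close> leads to \<open>w\<^sub>2\<close>, the
        \<open>length rs\<close> positions before it hold no neighbour of \<open>w\<close>; they
        make room for \<open>card Z\<close>.\<close>
      have "A \<inter> {m - length rs..<m} = {}"
      proof (rule ccontr)
        assume "\<not> ?thesis"
        then obtain i where "i \<in> A" "m - length rs \<le> i" "i < m" by auto
        then show False using gap[of i] by linarith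
      qed
      then have "card A + card {m - length rs..<m} = card (A \<union> {m - length rs..<m})"
        using fin by (simp add: card_Un_disjoint)
      also have "\<dots> \<le> card {..<k}" by (rule card_mono) (use A m in auto)
      finally show ?thesis using mr len \<open>B = {}\<close> by simp
    qed
  qed
  have dQ: "distinct Q" using c C(2) by simp
  have onw: "card {v \<in> set C. E w v} = card A"
  proof -
    have "{v \<in> set C. E w v} = {v \<in> set Q. E w v}" using C(2) E_irrefl by auto
    then show ?thesis using card_filter_set_nth[OF dQ] by (simp add: A_def k_def)
  qed
  have onx: "card {v \<in> set C. E x v} = card B + (if E w x then 1 else 0)"
  proof -
    have "E x w = E w x" using E_sym by blast
    then have "{v \<in> set C. E x v} = {v \<in> set Q. E x v} \<union> (if E w x then {w} else {})"
      using C(2) by auto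
    moreover have "card {v \<in> set Q. E x v} = card B"
      using card_filter_set_nth[OF dQ] by (simp add: B_def k_def)
    ultimately show ?thesis using c(3) by simp
  qed
  \<comment> \<open>If \<open>w\<close> and \<open>x\<close> are not adjacent, \<open>x\<close> is a
    vertex off \<open>C\<close> adjacent to neither of them and can be left out of the
    count.\<close>
  have out: "card {v. E w v \<and> v \<notin> set C} + card {v. E x v \<and> v \<notin> set C} + (if E w x then 0 else 1)
    \<le> card (V - set C) + card X"
  proof (cases "E w x")
    case True
    then show ?thesis using card_outside_nbrs[OF c(2), of w x] by (simp add: X_def)
  next
    case False
    let ?S = "insert x (set C)"
    have "{v. E z v \<and> v \<notin> set C} = {v. E z v \<and> v \<notin> ?S}" if "z = w \<or> z = x" for z
      using that False E_irrefl by auto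
    moreover have "X = {v. E w v \<and> E x v \<and> v \<notin> ?S}" using xX by (auto simp: X_def)
    moreover have "card (V - set C) = card (V - ?S) + 1"
    proof -
      have "V - ?S = (V - set C) - {x}" by blast
      then show ?thesis using finite_V x by (metis Suc_eq_plus1 card_Suc_Diff1 finite_Diff)
    qed
    ultimately show ?thesis using card_outside_nbrs[of ?S w x] c(2) x False by simp
  qed
  have "card (V - set C) = card V - length C" "length C \<le> card V"
    using c finite_V by (simp_all add: card_Diff_subset distinct_card) (metis card_mono distinct_card)
  moreover have "length C = k + 1" by (simp add: C(2) k_def)
  moreover have "card Z = card X + (if E w x then 1 else 0)"
    using finX xX by (simp add: Z_def)
  \<comment> \<open>An edge between \<open>w\<close> and \<open>x\<close> adds one to the neighbours
    of \<open>x\<close> on \<open>C\<close> and one to \<open>Z\<close>, so the two cancel;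
    strictness comes from \<open>length C = k + 1\<close>.\<close>
  ultimately show ?thesis
    using deg_split[of w "set C"] deg_split[of x "set C"] onw onx out main
    by (cases "E w x") simp_all
qed

end

section \<open>Induced paths on six vertices\<close>

locale p6_o_heavy = two_connected_claw_o_heavy +
  assumes p6: "distinct [v\<^sub>1, v\<^sub>2, v\<^sub>3, v\<^sub>4, v\<^sub>5, v\<^sub>6] \<Longrightarrow>
      E v\<^sub>1 v\<^sub>2 \<Longrightarrow> E v\<^sub>2 v\<^sub>3 \<Longrightarrow> E v\<^sub>3 v\<^sub>4 \<Longrightarrow> E v\<^sub>4 v\<^sub>5 \<Longrightarrow> E v\<^sub>5 v\<^sub>6 \<Longrightarrow>
      \<not> E v\<^sub>1 v\<^sub>3 \<Longrightarrow> \<not> E v\<^sub>1 v\<^sub>4 \<Longrightarrow> \<not> E v\<^sub>1 v\<^sub>5 \<Longrightarrow> \<not> E v\<^sub>1 v\<^sub>6 \<Longrightarrow> \<not> E v\<^sub>2 v\<^sub>4 \<Longrightarrow> \<not> E v\<^sub>2 v\<^sub>5 \<Longrightarrow>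
      \<not> E v\<^sub>2 v\<^sub>6 \<Longrightarrow> \<not> E v\<^sub>3 v\<^sub>5 \<Longrightarrow> \<not> E v\<^sub>3 v\<^sub>6 \<Longrightarrow> \<not> E v\<^sub>4 v\<^sub>6 \<Longrightarrow>
      \<exists>a \<in> {v\<^sub>1, v\<^sub>2, v\<^sub>3}. \<exists>b \<in> {v\<^sub>4, v\<^sub>5, v\<^sub>6}. card V \<le> deg a + deg b"
begin

text \<open>Failure of \<open>F\<close> excludes an edge and a heavy degree sum at once. The pair
  \<open>v\<^sub>3\<close>, \<open>v\<^sub>4\<close> is an edge, so its degree sum is bounded
  separately.\<close>

lemma no_light_p6:
  assumes "distinct [v\<^sub>1, v\<^sub>2, v\<^sub>3, v\<^sub>4, v\<^sub>5, v\<^sub>6]"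
    and E: "E v\<^sub>1 v\<^sub>2" "E v\<^sub>2 v\<^sub>3" "E v\<^sub>3 v\<^sub>4" "E v\<^sub>4 v\<^sub>5" "E v\<^sub>5 v\<^sub>6" "\<not> E v\<^sub>1 v\<^sub>3" "\<not> E v\<^sub>4 v\<^sub>6"
    and F: "\<not> F v\<^sub>1 v\<^sub>4" "\<not> F v\<^sub>1 v\<^sub>5" "\<not> F v\<^sub>1 v\<^sub>6" "\<not> F v\<^sub>2 v\<^sub>4" "\<not> F v\<^sub>2 v\<^sub>5" "\<not> F v\<^sub>2 v\<^sub>6"
      "\<not> F v\<^sub>3 v\<^sub>5" "\<not> F v\<^sub>3 v\<^sub>6"
    and d: "deg v\<^sub>3 + deg v\<^sub>4 < card V"
  shows False
proof -
  have V: "v\<^sub>1 \<in> V" "v\<^sub>2 \<in> V" "v\<^sub>3 \<in> V" "v\<^sub>4 \<in> V" "v\<^sub>5 \<in> V" "v\<^sub>6 \<in> V"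
    using E(1-5) E_V E_V2 by blast+
  have n: "\<not> E u v \<and> deg u + deg v < card V" if "\<not> F u v" "u \<noteq> v" "u \<in> V" "v \<in> V" for u v
    using that by (auto simp: F_def)
  have "\<not> E v\<^sub>1 v\<^sub>4 \<and> deg v\<^sub>1 + deg v\<^sub>4 < card V" "\<not> E v\<^sub>1 v\<^sub>5 \<and> deg v\<^sub>1 + deg v\<^sub>5 < card V"
    "\<not> E v\<^sub>1 v\<^sub>6 \<and> deg v\<^sub>1 + deg v\<^sub>6 < card V" "\<not> E v\<^sub>2 v\<^sub>4 \<and> deg v\<^sub>2 + deg v\<^sub>4 < card V"
    "\<not> E v\<^sub>2 v\<^sub>5 \<and> deg v\<^sub>2 + deg v\<^sub>5 < card V" "\<not> E v\<^sub>2 v\<^sub>6 \<and> deg v\<^sub>2 + deg v\<^sub>6 < card V"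
    "\<not> E v\<^sub>3 v\<^sub>5 \<and> deg v\<^sub>3 + deg v\<^sub>5 < card V" "\<not> E v\<^sub>3 v\<^sub>6 \<and> deg v\<^sub>3 + deg v\<^sub>6 < card V"
    by (rule n; use F V assms(1) in simp)+
  then show False
    using p6[OF assms(1) E(1-6) _ _ _ _ _ _ _ _ E(7)] d by (simp add: not_le[symmetric])
qed

text \<open>The initial run of neighbours of \<open>w\<^sub>1\<close> on \<open>Q\<close> contains
  \<open>hd Q\<close> and, by \<open>two_ends\<close>, stops before \<open>last Q\<close>. Its last
  vertex \<open>a\<close> is split off because both \<open>I\<close> and \<open>I @ [a]\<close> will
  serve as the moved block in reroutings.\<close>

lemma first_non_neighbour:
  assumes C: "longest C" "C = w\<^sub>1 # Q @ w\<^sub>2 # Q'"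
    and att: "attached C w\<^sub>1"
    and ps: "out_path C w\<^sub>1 ps" "F (last ps) w\<^sub>2"
  obtains I a y S where "Q = I @ a # y # S" "I = [] \<or> E w\<^sub>1 (last I)" "E w\<^sub>1 a" "\<not> E w\<^sub>1 y"
proof -
  have Q: "Q \<noteq> []" "\<not> E w\<^sub>1 (last Q)" using two_ends[OF C att ps] by auto
  define J where "J = takeWhile (E w\<^sub>1) Q"
  have "E w\<^sub>1 (hd Q)" using cycle_neighbours(1)[of w\<^sub>1 "Q @ w\<^sub>2 # Q'"] C Q by simp
  then have J: "J \<noteq> []" "\<And>v. v \<in> set J \<Longrightarrow> E w\<^sub>1 v"
    using Q(1) by (cases Q; auto simp: J_def dest: set_takeWhileD)+
  have "dropWhile (E w\<^sub>1) Q \<noteq> []" using Q by (auto simp: dropWhile_eq_Nil_conv)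
  then obtain y S where y: "dropWhile (E w\<^sub>1) Q = y # S" "\<not> E w\<^sub>1 y"
    by (metis hd_dropWhile list.exhaust_sel)
  obtain I a where I: "J = I @ [a]" using J(1) rev_exhaust by blast
  have "Q = J @ y # S" using y by (metis J_def takeWhile_dropWhile_id)
  then have "Q = I @ a # y # S" using I by simp
  moreover have "I = [] \<or> E w\<^sub>1 (last I)" using J(2)[of "last I"] I by (cases "I = []") auto
  moreover have "E w\<^sub>1 a" using J(2) I by simp
  ultimately show ?thesis using that y(2) by blast
qed

lemma out_path_prefix:
  "out_path C w (ps @ x # qs) \<Longrightarrow> out_path C w (ps @ [x])"
  by (auto simp: out_path_def successively_append_iff successively_Cons hd_append split: if_splits)

text \<open>A shortest such walk has no chords and meets the two neighbourhoods only at its ends, so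
  an induced path on six vertices can be read off. The cases are an edge between
  \<open>w\<^sub>1\<close> and \<open>w\<^sub>2\<close>, and walks of one, two or at least three
  vertices.\<close>

lemma no_outside_walk:
  assumes C: "longest C" "C = w\<^sub>1 # Q @ w\<^sub>2 # Q'"
    and w: "walk (V - set C) {v. E v w\<^sub>1} {v. E v w\<^sub>2} qs"
  shows False
proof -
  obtain ps where ps: "walk (V - set C) {v. E v w\<^sub>1} {v. E v w\<^sub>2} ps" "distinct ps"
    and ps1: "set (tl ps) \<inter> {v. E v w\<^sub>1} = {}" and ps2: "set (butlast ps) \<inter> {v. E v w\<^sub>2} = {}"
    and ind: "\<And>as x bs y cs. ps = as @ x # bs @ y # cs \<Longrightarrow> bs \<noteq> [] \<Longrightarrow> \<not> E x y"
    using shortest_walk[OF w] by metis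
  have c: "distinct C" "set C \<subseteq> V" using longest_cyc_E[OF C(1)] by (auto simp: cyc_def)
  have ne: "ps \<noteq> []" and E1: "E w\<^sub>1 (hd ps)" and E2: "E (last ps) w\<^sub>2"
    and psV: "set ps \<subseteq> V - set C" and sE: "successively E ps"
    using ps(1) E_sym by (auto simp: walk_def)
  have p: "out_path C w\<^sub>1 ps" "F (last ps) w\<^sub>2"
    using ne E1 E2 E_F sE ps(2) psV successively_E_F by (auto simp: out_path_def)
  have "hd ps \<in> set ps" "last ps \<in> set ps" using ne by auto
  then have att: "attached C w\<^sub>1" "attached C w\<^sub>2"
    using E1 E_sym[OF E2] psV unfolding attached_def by blast+
  \<comment> \<open>A rotation, not a reversal: from \<open>w\<^sub>2\<close> the cycle is followed
    in the same direction, as \<open>not_F_across\<close> requires.\<close>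
  let ?D = "w\<^sub>2 # Q' @ w\<^sub>1 # Q"
  have D: "longest ?D" using longest_append_commute[of "w\<^sub>1 # Q" "w\<^sub>2 # Q'"] C by simp
  have s: "set ?D = set C" using C(2) by auto
  have att': "attached ?D w\<^sub>1" "attached ?D w\<^sub>2" using att attached_cong[OF s] by blast+
  have p': "out_path ?D w\<^sub>2 (rev ps)" "F (last (rev ps)) w\<^sub>1"
    using out_path_rev[OF p] out_path_cong[OF s] E1 E_F E_sym by (auto simp: last_rev)
  obtain I\<^sub>1 a\<^sub>1 y\<^sub>1 S\<^sub>1 where Q: "Q = I\<^sub>1 @ a\<^sub>1 # y\<^sub>1 # S\<^sub>1"
    and I1: "I\<^sub>1 = [] \<or> E w\<^sub>1 (last I\<^sub>1)" and a1: "E w\<^sub>1 a\<^sub>1" and y1: "\<not> E w\<^sub>1 y\<^sub>1"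
    using first_non_neighbour[OF C att(1) p] .
  obtain I\<^sub>2 a\<^sub>2 y\<^sub>2 S\<^sub>2 where Q': "Q' = I\<^sub>2 @ a\<^sub>2 # y\<^sub>2 # S\<^sub>2"
    and I2: "I\<^sub>2 = [] \<or> E w\<^sub>2 (last I\<^sub>2)" and a2: "E w\<^sub>2 a\<^sub>2" and y2: "\<not> E w\<^sub>2 y\<^sub>2"
    using first_non_neighbour[OF D refl att'(2) p'] .
  have cE: "cyc V E C" using longest_cyc_E[OF C(1)] .
  have ay: "E a\<^sub>1 y\<^sub>1" "E a\<^sub>2 y\<^sub>2"
    using cE unfolding cyc_def C(2) Q Q' by (auto simp: successively_append_iff successively_Cons)
  have dis: "distinct [y\<^sub>1, a\<^sub>1, w\<^sub>1, w\<^sub>2, a\<^sub>2, y\<^sub>2]" using c(1) unfolding C(2) Q Q' by auto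
  have inC: "{y\<^sub>1, a\<^sub>1, w\<^sub>1, w\<^sub>2, a\<^sub>2, y\<^sub>2} \<subseteq> set C" unfolding C(2) Q Q' by auto
  have l: "0 < length ps" "0 < length (rev ps)" using ne by auto
  \<comment> \<open>With \<open>K\<close> empty, \<open>a\<^sub>1\<close> and
    \<open>y\<^sub>1\<close> both take the place of \<open>z\<close>, after the blocks
    \<open>I\<^sub>1\<close> and \<open>I\<^sub>1 @ [a\<^sub>1]\<close>.\<close>
  have C1: "C = w\<^sub>1 # I\<^sub>1 @ [] @ a\<^sub>1 # (y\<^sub>1 # S\<^sub>1 @ w\<^sub>2 # Q')"
    "C = w\<^sub>1 # (I\<^sub>1 @ [a\<^sub>1]) @ [] @ y\<^sub>1 # (S\<^sub>1 @ w\<^sub>2 # Q')" using C(2) Q by auto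
  have C2: "?D = w\<^sub>2 # I\<^sub>2 @ [] @ a\<^sub>2 # (y\<^sub>2 # S\<^sub>2 @ w\<^sub>1 # Q)"
    "?D = w\<^sub>2 # (I\<^sub>2 @ [a\<^sub>2]) @ [] @ y\<^sub>2 # (S\<^sub>2 @ w\<^sub>1 # Q)" using Q' by auto
  have J1: "I\<^sub>1 @ [a\<^sub>1] = [] \<or> E w\<^sub>1 (last (I\<^sub>1 @ [a\<^sub>1]))" using a1 by simp
  have J2: "I\<^sub>2 @ [a\<^sub>2] = [] \<or> E w\<^sub>2 (last (I\<^sub>2 @ [a\<^sub>2]))" using a2 by simp
  have x1: "\<not> F a\<^sub>1 x" "\<not> F y\<^sub>1 x" "deg w\<^sub>1 + deg x < card V" if x: "x \<in> set ps" for x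
  proof -
    \<comment> \<open>The initial part of \<open>ps\<close> ending at \<open>x\<close> is itself a
      path off \<open>C\<close> starting next to \<open>w\<^sub>1\<close>.\<close>
    obtain as bs where d: "ps = as @ x # bs" using x by (meson split_list)
    then have o: "out_path C w\<^sub>1 (as @ [x])" using out_path_prefix p(1) by blast
    show "\<not> F a\<^sub>1 x"
      using not_F_after_outside[OF C(1) C1(1) att(1) I1 o] F_sym by auto
    show "\<not> F y\<^sub>1 x"
      using not_F_after_outside[OF C(1) C1(2) att(1) J1 o] F_sym by auto
    show "deg w\<^sub>1 + deg x < card V"
      using deg_sum_outside[OF C att(1) o] by simp
  qed
  have x2: "\<not> F a\<^sub>2 x" if x: "x \<in> set ps" for x
  proof -
    obtain as bs where d: "rev ps = as @ x # bs" using x by (metis set_rev split_list)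
    then have o: "out_path ?D w\<^sub>2 (as @ [x])" using out_path_prefix p'(1) by metis
    show "\<not> F a\<^sub>2 x"
      using not_F_after_outside[OF D C2(1) att'(2) I2 o] F_sym by auto
  qed
  have w2: "\<not> F a\<^sub>1 w\<^sub>2" "\<not> F y\<^sub>1 w\<^sub>2"
    using not_F_second_end[OF C(1) _ att I1 p, of "[]" a\<^sub>1 "y\<^sub>1 # S\<^sub>1" Q']
      not_F_second_end[OF C(1) _ att J1 p, of "[]" y\<^sub>1 "S\<^sub>1" Q'] C1 l F_sym by auto
  have w1: "\<not> F w\<^sub>1 a\<^sub>2" "\<not> F w\<^sub>1 y\<^sub>2"
    using not_F_second_end[OF D _ att'(2,1) I2 p', of "[]" a\<^sub>2 "y\<^sub>2 # S\<^sub>2" Q]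
      not_F_second_end[OF D _ att'(2,1) J2 p', of "[]" y\<^sub>2 "S\<^sub>2" Q] C2 l by auto
  have across: "\<not> F a\<^sub>1 a\<^sub>2" "\<not> F a\<^sub>1 y\<^sub>2" "\<not> F y\<^sub>1 a\<^sub>2" "\<not> F y\<^sub>1 y\<^sub>2"
    using not_F_across[OF C(1) _ att I1 I2 p, of a\<^sub>1 "y\<^sub>1 # S\<^sub>1" a\<^sub>2 "y\<^sub>2 # S\<^sub>2"]
      not_F_across[OF C(1) _ att I1 J2 p, of a\<^sub>1 "y\<^sub>1 # S\<^sub>1" y\<^sub>2 "S\<^sub>2"]
      not_F_across[OF C(1) _ att J1 I2 p, of y\<^sub>1 "S\<^sub>1" a\<^sub>2 "y\<^sub>2 # S\<^sub>2"]
      not_F_across[OF C(1) _ att J1 J2 p, of y\<^sub>1 "S\<^sub>1" y\<^sub>2 "S\<^sub>2"] C(2) Q Q' by auto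
  have dw: "deg w\<^sub>1 + deg w\<^sub>2 < card V" using deg_sum_two_ends[OF C att p] .
  have nF: "\<not> F u v" if "\<not> E u v" "deg u + deg v < card V" for u v
    using that by (auto simp: F_def)
  have sym: "E a\<^sub>1 w\<^sub>1" "E y\<^sub>1 a\<^sub>1" "\<not> E y\<^sub>1 w\<^sub>1" using a1 ay y1 E_sym by blast+
  show False
  proof (cases "E w\<^sub>1 w\<^sub>2")
    case True
    then show False
      using no_light_p6[of y\<^sub>1 a\<^sub>1 w\<^sub>1 w\<^sub>2 a\<^sub>2 y\<^sub>2] dis sym a2 ay(2) y2 w1 w2 across dw by blast
  next
    case False
    then have ww: "\<not> F w\<^sub>1 w\<^sub>2" using nF dw by blast
    obtain x\<^sub>1 ps' where x1': "ps = x\<^sub>1 # ps'" using ne by (cases ps) auto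
    have Ew: "E w\<^sub>1 x\<^sub>1" using E1 x1' by simp
    have x1C: "x\<^sub>1 \<notin> set C" using psV x1' by auto
    show False
    proof (cases ps')
      case Nil
      have "\<not> E x\<^sub>1 a\<^sub>2" using x2[of x\<^sub>1] x1' E_F E_sym by auto
      moreover have "distinct [y\<^sub>1, a\<^sub>1, w\<^sub>1, x\<^sub>1, w\<^sub>2, a\<^sub>2]" using dis inC x1C by auto
      moreover have "E x\<^sub>1 w\<^sub>2" using E2 x1' Nil by simp
      ultimately show False
        using no_light_p6[of y\<^sub>1 a\<^sub>1 w\<^sub>1 x\<^sub>1 w\<^sub>2 a\<^sub>2] sym Ew a2 w1 w2 across ww x1[of x\<^sub>1] x1' by simp
    next
      case (Cons x\<^sub>2 ps'')
      have E12: "E x\<^sub>1 x\<^sub>2" using sE x1' Cons by simp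
      have x2C: "x\<^sub>2 \<notin> set C" "x\<^sub>1 \<noteq> x\<^sub>2" using psV ps(2) x1' Cons by auto
      have "\<not> E w\<^sub>1 x\<^sub>2" using ps1 x1' Cons E_sym by auto
      then have wx2: "\<not> F w\<^sub>1 x\<^sub>2" using nF x1(3)[of x\<^sub>2] x1' Cons by simp
      show False
      proof (cases ps'')
        case Nil
        have "\<not> E x\<^sub>1 w\<^sub>2" using ps2 x1' Cons Nil by simp
        moreover have "distinct [y\<^sub>1, a\<^sub>1, w\<^sub>1, x\<^sub>1, x\<^sub>2, w\<^sub>2]" using dis inC x1C x2C by auto
        moreover have "E x\<^sub>2 w\<^sub>2" using E2 x1' Cons Nil by simp
        ultimately show False
          using no_light_p6[of y\<^sub>1 a\<^sub>1 w\<^sub>1 x\<^sub>1 x\<^sub>2 w\<^sub>2] sym Ew E12 w2 ww wx2 x1[of x\<^sub>1] x1[of x\<^sub>2]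
            x1' Cons by simp
      next
        case (Cons x\<^sub>3 ps''')
        note ps''' = x1' \<open>ps' = x\<^sub>2 # ps''\<close> Cons
        have "\<not> E w\<^sub>1 x\<^sub>3" using ps1 ps''' E_sym by auto
        then have wx3: "\<not> F w\<^sub>1 x\<^sub>3" using nF x1(3)[of x\<^sub>3] ps''' by simp
        have "x\<^sub>3 \<notin> set C" "x\<^sub>1 \<noteq> x\<^sub>3" "x\<^sub>2 \<noteq> x\<^sub>3" using psV ps(2) ps''' by auto
        then have "distinct [y\<^sub>1, a\<^sub>1, w\<^sub>1, x\<^sub>1, x\<^sub>2, x\<^sub>3]" using dis inC x1C x2C by auto
        moreover have "\<not> E x\<^sub>1 x\<^sub>3" using ind[of "[]" x\<^sub>1 "[x\<^sub>2]" x\<^sub>3 ps'''] ps''' by simp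
        moreover have "E x\<^sub>2 x\<^sub>3" using sE ps''' by simp
        ultimately show False
          using no_light_p6[of y\<^sub>1 a\<^sub>1 w\<^sub>1 x\<^sub>1 x\<^sub>2 x\<^sub>3] sym Ew E12 wx2 wx3
            x1[of x\<^sub>1] x1[of x\<^sub>2] x1[of x\<^sub>3] ps''' by simp
      qed
    qed
  qed
qed

text \<open>From a vertex off \<open>C\<close>, \<open>exit_walk\<close> is applied twice, the
  second time with \<open>w\<^sub>1\<close> deleted, so the walks lead to distinct vertices of
  \<open>C\<close>. Joined at \<open>x\<close>, they form a walk excluded by
  \<open>no_outside_walk\<close>.\<close>

lemma longest_spans:
  assumes C: "longest C"
  shows "set C = V"
proof (rule ccontr)
  assume "set C \<noteq> V"
  have c: "distinct C" "set C \<subseteq> V" "3 \<le> length C" using longest_cyc_E[OF C] by (auto simp: cyc_def)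
  then obtain x where x: "x \<in> V - set C" using \<open>set C \<noteq> V\<close> by blast
  have other: "\<exists>v \<in> set C. v \<noteq> w" for w
  proof (rule ccontr)
    assume "\<not> ?thesis"
    then have "set C \<subseteq> {w}" by blast
    then have "card (set C) \<le> 1" using card_mono[of "{w}"] by simp
    then show False using c by (simp add: distinct_card)
  qed
  obtain w where "w \<in> set C" using other by blast
  then obtain ps\<^sub>1 w\<^sub>1 where p1: "walk (V - set C) {x} {v. E v w\<^sub>1} ps\<^sub>1" "w\<^sub>1 \<in> set C"
    using exit_walk[OF c(2) x] other[of w] by metis
  then obtain ps\<^sub>2 w\<^sub>2 where p2: "walk (V - set C) {x} {v. E v w\<^sub>2} ps\<^sub>2" "w\<^sub>2 \<in> set C" "w\<^sub>2 \<noteq> w\<^sub>1"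
    using exit_walk[OF c(2) x] other[of w\<^sub>1] by metis
  have r: "walk (V - set C) {v. E v w\<^sub>1} {x} (rev ps\<^sub>1)" using walk_rev p1(1) by blast
  obtain qs where qs: "ps\<^sub>2 = x # qs" using p2(1) by (cases ps\<^sub>2) (auto simp: walk_def)
  have walk: "walk (V - set C) {v. E v w\<^sub>1} {v. E v w\<^sub>2} (rev ps\<^sub>1 @ qs)"
    using r p2(1) by (auto simp: walk_def qs successively_append_iff successively_Cons split: if_splits)
  obtain as bs where d: "C = as @ w\<^sub>1 # bs" using p1(2) by (meson split_list)
  let ?C = "w\<^sub>1 # bs @ as"
  have "longest ?C" using longest_append_commute[of as "w\<^sub>1 # bs"] C d by simp
  have "w\<^sub>2 \<in> set (bs @ as)" using p2 d by auto
  then obtain Q Q' where "bs @ as = Q @ w\<^sub>2 # Q'" by (meson split_list)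
  moreover have "set ?C = set C" using d by auto
  ultimately show False
    using no_outside_walk[of ?C w\<^sub>1 Q w\<^sub>2 Q'] \<open>longest ?C\<close> walk by simp
qed

text \<open>Deleting another vertex cannot isolate \<open>u\<close>, so \<open>u\<close> has two
  neighbours \<open>a\<close> and \<open>b\<close>; with \<open>u\<close> deleted they remain joined
  by a path, which \<open>u\<close> closes.\<close>

lemma cycle_exists:
  assumes "3 \<le> card V"
  shows "\<exists>C. cyc V E C"
proof -
  have pick: "\<exists>v \<in> V. v \<notin> S" if "finite S" "card S \<le> 2" for S
  proof (rule ccontr)
    assume "\<not> ?thesis"
    then have "card V \<le> card S" using that(1) by (intro card_mono) auto
    then show False using assms that by linarith
  qed
  obtain u where u: "u \<in> V" using pick[of "{}"] by auto
  have nbr: "\<exists>b. E u b \<and> b \<noteq> w" if "w \<in> V" "w \<noteq> u" for w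
  proof -
    have "card {u, w} \<le> 2" using card_length[of "[u, w]"] by simp
    then obtain v where v: "v \<in> V" "v \<noteq> u" "v \<noteq> w" using pick[of "{u, w}"] by auto
    have "(\<lambda>a b. E a b \<and> a \<noteq> w \<and> b \<noteq> w)\<^sup>*\<^sup>* u v"
      using connected_minus[of w u v] that u v by blast
    then show ?thesis using v(2) by (cases rule: converse_rtranclpE) auto
  qed
  obtain v where "v \<in> V" "v \<noteq> u" using pick[of "{u}"] by auto
  then obtain a where a: "E u a" using nbr by blast
  then have aV: "a \<in> V" "a \<noteq> u" using E_V2 E_irrefl by auto
  then obtain b where b: "E u b" "b \<noteq> a" using nbr by blast
  then have bV: "b \<in> V" "b \<noteq> u" using E_V2 E_irrefl by auto
  have "(\<lambda>c d. E c d \<and> c \<noteq> u \<and> d \<noteq> u)\<^sup>*\<^sup>* a b"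
    using connected_minus[OF u] aV bV by blast
  then have "\<exists>qs. walk (V - {u}) {a} {b} qs"
    using aV bV
  proof (induction rule: converse_rtranclp_induct)
    case base
    then show ?case by (intro exI[of _ "[b]"]) (simp add: walk_def)
  next
    case (step c d)
    then obtain qs where "walk (V - {u}) {d} {b} qs" using E_V2 by blast
    then have "walk (V - {u}) {c} {b} (c # qs)"
      using step by (auto simp: walk_def successively_Cons)
    then show ?case by blast
  qed
  then obtain qs where "walk (V - {u}) {a} {b} qs" "distinct qs"
    using shortest_walk by metis
  then have q: "set qs \<subseteq> V - {u}" "successively E qs" "hd qs = a" "last qs = b" "distinct qs" "qs \<noteq> []"
    by (auto simp: walk_def)
  have "2 \<le> length qs" using q b(2) by (cases qs; cases "tl qs") auto
  then have "cyc V E (u # qs)"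
    using q u a E_sym[OF b(1)] by (auto simp: cyc_def successively_Cons)
  then show ?thesis by blast
qed

end

section \<open>From digraphs to adjacency relations\<close>

lemma (in graph) dominates_sym: "u \<rightarrow>\<^bsub>G\<^esub> v \<Longrightarrow> v \<rightarrow>\<^bsub>G\<^esub> u"
  using sym_arcs by (auto simp: symmetric_def dest: symD)

lemma (in graph) simple_graph_dominates: "simple_graph (verts G) (\<lambda>u v. u \<rightarrow>\<^bsub>G\<^esub> v)"
  by unfold_locales (auto dest: dominates_sym adj_in_verts adj_not_same)

lemma (in graph) deg_eq_out_degree:
  "simple_graph.deg (\<lambda>u v. u \<rightarrow>\<^bsub>G\<^esub> v) v = out_degree G v"
proof -
  interpret simple_graph "verts G" "\<lambda>u v. u \<rightarrow>\<^bsub>G\<^esub> v" by (rule simple_graph_dominates)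
  have "bij_betw (head G) (out_arcs G v) {u. v \<rightarrow>\<^bsub>G\<^esub> u}"
    unfolding bij_betw_def
  proof
    show "inj_on (head G) (out_arcs G v)"
      by (rule inj_onI) (auto simp: out_arcs_def arc_to_ends_def intro!: no_multi_arcs)
    show "head G ` out_arcs G v = {u. v \<rightarrow>\<^bsub>G\<^esub> u}"
      by (auto simp: out_arcs_def arcs_ends_conv image_iff)
  qed
  then show ?thesis by (simp add: deg_def out_degree_def bij_betw_same_card)
qed

text \<open>If no two leaves are adjacent, the four vertices induce a claw. Its nonadjacent heavy
  pair avoids the centre \<open>w\<close>, which is adjacent to every leaf.\<close>

lemma (in graph) claw_o_heavy_imp_locale:
  assumes "claw_o_heavy G"
  shows "claw_o_heavy_graph (verts G) (\<lambda>u v. u \<rightarrow>\<^bsub>G\<^esub> v)"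
proof -
  interpret simple_graph "verts G" "\<lambda>u v. u \<rightarrow>\<^bsub>G\<^esub> v" by (rule simple_graph_dominates)
  show ?thesis
  proof unfold_locales
    fix w a b c
    assume E: "w \<rightarrow>\<^bsub>G\<^esub> a" "w \<rightarrow>\<^bsub>G\<^esub> b" "w \<rightarrow>\<^bsub>G\<^esub> c" and d: "distinct [a, b, c]"
    show "F a b \<or> F a c \<or> F b c"
    proof (cases "a \<rightarrow>\<^bsub>G\<^esub> b \<or> a \<rightarrow>\<^bsub>G\<^esub> c \<or> b \<rightarrow>\<^bsub>G\<^esub> c")
      case True
      then show ?thesis using E_F by blast
    next
      case False
      let ?S = "{w, a, b, c}" and ?H = "G \<restriction> {w, a, b, c}"
      have V: "w \<in> verts G" "a \<in> verts G" "b \<in> verts G" "c \<in> verts G"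
        using E adj_in_verts by blast+
      then have ind: "induced_subgraph ?H G" by (intro induced_induce) simp
      have w: "w \<notin> {a, b, c}" using E E_irrefl by auto
      have no: "\<not> u \<rightarrow>\<^bsub>G\<^esub> v" if "u \<in> {a, b, c}" "v \<in> {a, b, c}" for u v
        using that False E_irrefl dominates_sym by blast
      have yes: "w \<rightarrow>\<^bsub>G\<^esub> v" "v \<rightarrow>\<^bsub>G\<^esub> w" if "v \<in> {a, b, c}" for v
        using that E dominates_sym by blast+
      have "arcs_ends ?H = {(u, v). u \<rightarrow>\<^bsub>G\<^esub> v \<and> u \<in> ?S \<and> v \<in> ?S}"
        by (auto simp: arcs_ends_conv)
      also have "\<dots> = {w} \<times> {a, b, c} \<union> {a, b, c} \<times> {w}"
      proof (intro set_eqI, clarify)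
        fix u v
        show "(u, v) \<in> {(u, v). u \<rightarrow>\<^bsub>G\<^esub> v \<and> u \<in> ?S \<and> v \<in> ?S} \<longleftrightarrow>
          (u, v) \<in> {w} \<times> {a, b, c} \<union> {a, b, c} \<times> {w}"
          using no[of u v] yes[of u] yes[of v] w E_irrefl[of w] by auto
      qed
      finally have ends: "arcs_ends ?H = {w} \<times> {a, b, c} \<union> {a, b, c} \<times> {w}" .
      interpret H: digraph ?H using ind by (rule digraphI_induced)
      interpret H: sym_digraph ?H using ind by (rule induced_graph_imp_graph)
      have "graph ?H" by unfold_locales
      moreover have "verts ?H = {w} \<union> {a, b, c}" by auto
      moreover have "{w} \<inter> {a, b, c} = {}" using w by simp
      moreover have "card {w} = 1" "card {a, b, c} = 3" using d by simp_all
      ultimately have "K\<^bsub>1,3\<^esub> ?H" unfolding complete_bipartite_digraph_def using ends by blast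
      then obtain u v where uv: "u \<in> ?S" "v \<in> ?S" "u \<noteq> v" "\<not> u \<rightarrow>\<^bsub>G\<^esub> v"
        "card (verts G) \<le> out_degree G u + out_degree G v"
        using assms ind unfolding claw_o_heavy_def by (metis induce_subgraph_verts)
      then have "u \<in> {a, b, c}" "v \<in> {a, b, c}" using yes by blast+
      moreover have "F u v" using uv V by (auto simp: F_def deg_eq_out_degree)
      ultimately show ?thesis using uv(3) F_sym by blast
    qed
  qed
qed

text \<open>The notion \<open>connected\<close> passes to the symmetric closure; as \<open>G\<close>
  is symmetric, each arc of that closure is an edge of \<open>G\<close> avoiding
  \<open>w\<close>.\<close>

lemma (in graph) rtranclp_of_two_connected:
  assumes "k_connected 2 G" and w: "w \<in> verts G" and uv: "u \<in> verts G - {w}" "v \<in> verts G - {w}"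
  shows "(\<lambda>a b. a \<rightarrow>\<^bsub>G\<^esub> b \<and> a \<noteq> w \<and> b \<noteq> w)\<^sup>*\<^sup>* u v"
proof -
  let ?H = "G \<restriction> (verts G - {w})"
  have "connected ?H" using assms(1) w unfolding k_connected_def by simp
  then have "u \<rightarrow>\<^sup>*\<^bsub>with_proj (mk_symmetric ?H)\<^esub> v"
    using uv by (auto simp: connected_def strongly_connected_def mk_symmetric_def)
  then have "(u, v) \<in> (arcs_ends (with_proj (mk_symmetric ?H)))\<^sup>*"
    by (rule reachable_rtranclI)
  moreover have "arcs_ends (with_proj (mk_symmetric ?H)) \<subseteq> {(a, b). a \<rightarrow>\<^bsub>G\<^esub> b \<and> a \<noteq> w \<and> b \<noteq> w}"
    using dominates_sym by (auto simp: mk_symmetric_def arcs_ends_conv)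
  ultimately have "(u, v) \<in> {(a, b). a \<rightarrow>\<^bsub>G\<^esub> b \<and> a \<noteq> w \<and> b \<noteq> w}\<^sup>*"
    using rtrancl_mono by blast
  then show ?thesis by (simp add: rtranclp_rtrancl_eq)
qed

lemma (in wf_digraph) awalk_of_vertices:
  assumes "u \<in> verts G" "successively (\<lambda>u v. u \<rightarrow>\<^bsub>G\<^esub> v) (u # xs)"
  shows "\<exists>p. awalk u p (last (u # xs)) \<and> awalk_verts u p = u # xs"
  using assms
proof (induction xs arbitrary: u)
  case Nil
  then show ?case by (intro exI[of _ "[]"]) (simp add: awalk_Nil_iff)
next
  case (Cons x xs)
  then obtain e where e: "e \<in> arcs G" "tail G e = u" "head G e = x" by auto
  moreover have "successively (\<lambda>u v. u \<rightarrow>\<^bsub>G\<^esub> v) (x # xs)" using Cons.prems by simp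
  ultimately obtain p where "awalk x p (last (x # xs))" "awalk_verts x p = x # xs"
    using Cons.IH[of x] by (metis head_in_verts)
  then show ?case
    using e by (intro exI[of _ "e # p"]) (simp add: awalk_Cons_iff)
qed

lemma (in graph) hamiltonian_of_cyc:
  assumes C: "cyc (verts G) (\<lambda>u v. u \<rightarrow>\<^bsub>G\<^esub> v) C" "set C = verts G"
  shows "hamiltonian G"
proof -
  obtain c cs where cs: "C = c # cs" using C(1) by (cases C) (auto simp: cyc_def)
  have "c \<in> verts G" "successively (\<lambda>u v. u \<rightarrow>\<^bsub>G\<^esub> v) (c # (cs @ [c]))"
    using C cs by (auto simp: cyc_def successively_append_iff successively_Cons split: if_splits)
  then obtain p where p: "awalk c p c" "awalk_verts c p = c # cs @ [c]"
    using awalk_of_vertices[of c "cs @ [c]"] by auto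
  have l: "length p = length C" using p(2) length_awalk_verts[of c p] cs by simp
  then have ne: "p \<noteq> []" using cs by auto
  \<comment> \<open>The tails of the arcs are the vertices of the walk except the last, which
    repeats \<open>c\<close>.\<close>
  then have "map (tail G) p = c # cs"
    using p(2) by (simp add: awalk_verts_conv butlast_append flip: butlast_snoc)
  then have "tail G ` set p = verts G" using C(2) cs by (metis set_map)
  moreover have "cycle p"
    unfolding cycle_def using p ne C(1) cs by (auto simp: cyc_def)
  ultimately show ?thesis
    unfolding hamiltonian_def using l C(1) by (auto simp: cyc_def)
qed

lemma (in graph) induced_path6:
  assumes d: "distinct [v\<^sub>1, v\<^sub>2, v\<^sub>3, v\<^sub>4, v\<^sub>5, v\<^sub>6]"
    and E: "v\<^sub>1 \<rightarrow>\<^bsub>G\<^esub> v\<^sub>2" "v\<^sub>2 \<rightarrow>\<^bsub>G\<^esub> v\<^sub>3" "v\<^sub>3 \<rightarrow>\<^bsub>G\<^esub> v\<^sub>4" "v\<^sub>4 \<rightarrow>\<^bsub>G\<^esub> v\<^sub>5" "v\<^sub>5 \<rightarrow>\<^bsub>G\<^esub> v\<^sub>6"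
    and nE: "\<not> v\<^sub>1 \<rightarrow>\<^bsub>G\<^esub> v\<^sub>3" "\<not> v\<^sub>1 \<rightarrow>\<^bsub>G\<^esub> v\<^sub>4" "\<not> v\<^sub>1 \<rightarrow>\<^bsub>G\<^esub> v\<^sub>5" "\<not> v\<^sub>1 \<rightarrow>\<^bsub>G\<^esub> v\<^sub>6" "\<not> v\<^sub>2 \<rightarrow>\<^bsub>G\<^esub> v\<^sub>4" "\<not> v\<^sub>2 \<rightarrow>\<^bsub>G\<^esub> v\<^sub>5"
      "\<not> v\<^sub>2 \<rightarrow>\<^bsub>G\<^esub> v\<^sub>6" "\<not> v\<^sub>3 \<rightarrow>\<^bsub>G\<^esub> v\<^sub>5" "\<not> v\<^sub>3 \<rightarrow>\<^bsub>G\<^esub> v\<^sub>6" "\<not> v\<^sub>4 \<rightarrow>\<^bsub>G\<^esub> v\<^sub>6"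
  shows "induced_path G [v\<^sub>1, v\<^sub>2, v\<^sub>3, v\<^sub>4, v\<^sub>5, v\<^sub>6]"
proof -
  let ?p = "[v\<^sub>1, v\<^sub>2, v\<^sub>3, v\<^sub>4, v\<^sub>5, v\<^sub>6]"
  interpret simple_graph "verts G" "\<lambda>u v. u \<rightarrow>\<^bsub>G\<^esub> v" by (rule simple_graph_dominates)
  have E': "v\<^sub>2 \<rightarrow>\<^bsub>G\<^esub> v\<^sub>1" "v\<^sub>3 \<rightarrow>\<^bsub>G\<^esub> v\<^sub>2" "v\<^sub>4 \<rightarrow>\<^bsub>G\<^esub> v\<^sub>3" "v\<^sub>5 \<rightarrow>\<^bsub>G\<^esub> v\<^sub>4" "v\<^sub>6 \<rightarrow>\<^bsub>G\<^esub> v\<^sub>5"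
    using E dominates_sym by blast+
  have nE': "\<not> v\<^sub>3 \<rightarrow>\<^bsub>G\<^esub> v\<^sub>1" "\<not> v\<^sub>4 \<rightarrow>\<^bsub>G\<^esub> v\<^sub>1" "\<not> v\<^sub>5 \<rightarrow>\<^bsub>G\<^esub> v\<^sub>1" "\<not> v\<^sub>6 \<rightarrow>\<^bsub>G\<^esub> v\<^sub>1" "\<not> v\<^sub>4 \<rightarrow>\<^bsub>G\<^esub> v\<^sub>2" "\<not> v\<^sub>5 \<rightarrow>\<^bsub>G\<^esub> v\<^sub>2"
      "\<not> v\<^sub>6 \<rightarrow>\<^bsub>G\<^esub> v\<^sub>2" "\<not> v\<^sub>5 \<rightarrow>\<^bsub>G\<^esub> v\<^sub>3" "\<not> v\<^sub>6 \<rightarrow>\<^bsub>G\<^esub> v\<^sub>3" "\<not> v\<^sub>6 \<rightarrow>\<^bsub>G\<^esub> v\<^sub>4"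
    using nE dominates_sym by blast+
  have "arcs_ends (G \<restriction> set ?p) = {(u, v). u \<rightarrow>\<^bsub>G\<^esub> v \<and> u \<in> set ?p \<and> v \<in> set ?p}"
    by (auto simp: arcs_ends_conv)
  also have "\<dots> = set (vwalk_arcs ?p) \<union> (set (vwalk_arcs ?p))\<inverse>"
  proof
    show "{(u, v). u \<rightarrow>\<^bsub>G\<^esub> v \<and> u \<in> set ?p \<and> v \<in> set ?p} \<subseteq> set (vwalk_arcs ?p) \<union> (set (vwalk_arcs ?p))\<inverse>"
    proof (rule subrelI)
      fix u v assume "(u, v) \<in> {(u, v). u \<rightarrow>\<^bsub>G\<^esub> v \<and> u \<in> set ?p \<and> v \<in> set ?p}"
      then have uv: "u \<rightarrow>\<^bsub>G\<^esub> v" and "u \<in> set ?p" "v \<in> set ?p" by simp_all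
      then have "u = v\<^sub>1 \<or> u = v\<^sub>2 \<or> u = v\<^sub>3 \<or> u = v\<^sub>4 \<or> u = v\<^sub>5 \<or> u = v\<^sub>6"
        "v = v\<^sub>1 \<or> v = v\<^sub>2 \<or> v = v\<^sub>3 \<or> v = v\<^sub>4 \<or> v = v\<^sub>5 \<or> v = v\<^sub>6" by simp_all
      then show "(u, v) \<in> set (vwalk_arcs ?p) \<union> (set (vwalk_arcs ?p))\<inverse>"
        using uv by (elim disjE) (simp_all add: nE nE' E_irrefl)
    qed
    show "set (vwalk_arcs ?p) \<union> (set (vwalk_arcs ?p))\<inverse> \<subseteq> {(u, v). u \<rightarrow>\<^bsub>G\<^esub> v \<and> u \<in> set ?p \<and> v \<in> set ?p}"
      using E E' by (simp add: subset_iff)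
  qed
  finally have "arcs_ends (G \<restriction> set ?p) = set (vwalk_arcs ?p) \<union> (set (vwalk_arcs ?p))\<inverse>" .
  moreover have "vpath ?p G" using d E E_V E_V2 by (auto intro!: vpathI vwalkI)
  ultimately show ?thesis by (simp add: induced_path_def)
qed

theorem theorem7:
  fixes G :: "('a,'b) pre_digraph" and n :: nat
  assumes "graph G"
    and "card (verts G) = n"
    and "k_connected 2 G"
    and "claw_o_heavy G"
    and "\<And>v :: nat \<Rightarrow> 'a. induced_path G [v 1, v 2, v 3, v 4, v 5, v 6] \<Longrightarrow>
           \<exists>i \<in> {1, 2, 3}. \<exists>j \<in> {4, 5, 6}. out_degree G (v i) + out_degree G (v j) \<ge> n"
  shows "hamiltonian G"
proof -
  interpret graph G by fact
  interpret claw_o_heavy_graph "verts G" "\<lambda>u v. u \<rightarrow>\<^bsub>G\<^esub> v"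
    using assms(4) by (rule claw_o_heavy_imp_locale)
  interpret p6_o_heavy "verts G" "\<lambda>u v. u \<rightarrow>\<^bsub>G\<^esub> v"
  proof unfold_locales
    fix w u v assume "w \<in> verts G" "u \<in> verts G - {w}" "v \<in> verts G - {w}"
    then show "(\<lambda>a b. a \<rightarrow>\<^bsub>G\<^esub> b \<and> a \<noteq> w \<and> b \<noteq> w)\<^sup>*\<^sup>* u v"
      using rtranclp_of_two_connected[OF assms(3)] by blast
  next
    fix v\<^sub>1 v\<^sub>2 v\<^sub>3 v\<^sub>4 v\<^sub>5 v\<^sub>6
    assume "distinct [v\<^sub>1, v\<^sub>2, v\<^sub>3, v\<^sub>4, v\<^sub>5, v\<^sub>6]"
      "v\<^sub>1 \<rightarrow>\<^bsub>G\<^esub> v\<^sub>2" "v\<^sub>2 \<rightarrow>\<^bsub>G\<^esub> v\<^sub>3" "v\<^sub>3 \<rightarrow>\<^bsub>G\<^esub> v\<^sub>4" "v\<^sub>4 \<rightarrow>\<^bsub>G\<^esub> v\<^sub>5" "v\<^sub>5 \<rightarrow>\<^bsub>G\<^esub> v\<^sub>6"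
      "\<not> v\<^sub>1 \<rightarrow>\<^bsub>G\<^esub> v\<^sub>3" "\<not> v\<^sub>1 \<rightarrow>\<^bsub>G\<^esub> v\<^sub>4" "\<not> v\<^sub>1 \<rightarrow>\<^bsub>G\<^esub> v\<^sub>5" "\<not> v\<^sub>1 \<rightarrow>\<^bsub>G\<^esub> v\<^sub>6" "\<not> v\<^sub>2 \<rightarrow>\<^bsub>G\<^esub> v\<^sub>4" "\<not> v\<^sub>2 \<rightarrow>\<^bsub>G\<^esub> v\<^sub>5"
      "\<not> v\<^sub>2 \<rightarrow>\<^bsub>G\<^esub> v\<^sub>6" "\<not> v\<^sub>3 \<rightarrow>\<^bsub>G\<^esub> v\<^sub>5" "\<not> v\<^sub>3 \<rightarrow>\<^bsub>G\<^esub> v\<^sub>6" "\<not> v\<^sub>4 \<rightarrow>\<^bsub>G\<^esub> v\<^sub>6"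
    then have "induced_path G [v\<^sub>1, v\<^sub>2, v\<^sub>3, v\<^sub>4, v\<^sub>5, v\<^sub>6]" by (rule induced_path6)
    \<comment> \<open>The hypothesis indexes the path from 1, whereas lists count from 0.\<close>
    moreover define f where "f i = [v\<^sub>1, v\<^sub>2, v\<^sub>3, v\<^sub>4, v\<^sub>5, v\<^sub>6] ! (i - 1)" for i :: nat
    ultimately have "induced_path G [f 1, f 2, f 3, f 4, f 5, f 6]" by simp
    then obtain i j where "i \<in> {1, 2, 3}" "j \<in> {4, 5, 6}"
      "n \<le> out_degree G (f i) + out_degree G (f j)"
      using assms(5)[of f] by blast
    moreover from this have "f i \<in> {v\<^sub>1, v\<^sub>2, v\<^sub>3}" "f j \<in> {v\<^sub>4, v\<^sub>5, v\<^sub>6}" by (auto simp: f_def)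
    ultimately show "\<exists>a \<in> {v\<^sub>1, v\<^sub>2, v\<^sub>3}. \<exists>b \<in> {v\<^sub>4, v\<^sub>5, v\<^sub>6}. card (verts G) \<le> deg a + deg b"
      using assms(2) by (auto simp: deg_eq_out_degree)
  qed
  have "3 \<le> card (verts G)" using assms(3) by (simp add: k_connected_def)
  then obtain C where "longest C" using cycle_exists longest_exists by blast
  then show ?thesis using hamiltonian_of_cyc longest_cyc_E longest_spans by blast
qed

end
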